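(* There is a constant $c>0$, independent of the triple $(\mathbf u_N,\boldsymbol p_N,\boldsymbol\lambda_N)$ (in particular independent of any mesh size and polynomial degree), such that for every $(\mathbf u_N,\boldsymbol p_N,\boldsymbol\lambda_N)\in V\times Q\times Q$ $$\|(\mathbf u^*-\mathbf u_N,\boldsymbol p^*-\boldsymbol p_N)\|^2+\mathsf E(\boldsymbol\mu^* )\le c\,\Big(\|(\mathbf u-\mathbf u_N,\boldsymbol p-\boldsymbol p_N)\|^2+\|\boldsymbol\lambda-\boldsymbol\lambda_N\|_{0,\Omega}^2+\|\boldsymbol p-\boldsymbol p_N\|_{0,\Omega}\Big),$$ where $(\mathbf u,\boldsymbol p,\boldsymbol\lambda)$ is the solution of the mixed problem, $(\mathbf u^*,\boldsymbol p^* )$ is the solution of the auxiliary problem associated with $\boldsymbol\lambda_N$, $\mathsf E(\boldsymbol\mu)=\|\boldsymbol\mu-\boldsymbol\lambda_N\|_{0,\Omega}^2+\psi(\boldsymbol p_N)-(\boldsymbol\mu,\boldsymbol p_N)_{0,\Omega}$ for $\boldsymbol\mu\in\Lambda$, and $\boldsymbol\mu^*=\min\{1,\sigma_y/|\widehat{\boldsymbol\mu}|_F\}\,\widehat{\boldsymbol\mu}\in\Lambda$ with $\widehat{\boldsymbol\mu}=\boldsymbol\lambda_N+\frac12\boldsymbol p_N$ (pointwise a.e., with $\boldsymbol\mu^*=0$ where $\widehat{\boldsymbol\mu}=0$).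
   Context: Let $d\in\{2,3\}$ and let $\Omega\subset\mathbb R^d$ be a bounded polygonal (polyhedral) domain with Lipschitz boundary $\Gamma=\partial\Omega$; $\Gamma_D\subseteq\Gamma$ is closed with positive surface measure and $\Gamma_N=\Gamma\setminus\Gamma_D$. Set $V=\{\mathbf v\in H^1(\Omega,\mathbb R^d):\mathbf v|_{\Gamma_D}=0\}$, $\mathbb S_{d,0}=\{\boldsymbol\tau\in\mathbb R^{d\times d}:\boldsymbol\tau=\boldsymbol\tau^\top,\ \operatorname{tr}(\boldsymbol\tau)=0\}$, $Q=L^2(\Omega,\mathbb S_{d,0})$. $(\cdot,\cdot)_{0,\Omega}$ and $\|\cdot\|_{0,\Omega}$ are the $L^2$ inner product and norm (with the Frobenius product $\boldsymbol p:\boldsymbol q$ and norm $|\cdot|_F$ for matrices). $\boldsymbol\varepsilon(\mathbf v)=\frac12(\nabla\mathbf v+(\nabla\mathbf v)^\top)$, $\|\mathbf v\|_{1,\Omega}^2=\|\mathbf v\|_{0,\Omega}^2+\|\boldsymbol\varepsilon(\mathbf v)\|_{0,\Omega}^2$, $\|(\mathbf v,\boldsymbol q)\|^2=\|\mathbf v\|_{1,\Omega}^2+\|\boldsymbol q\|_{0,\Omega}^2$. The elasticity tensor $\mathbb C$ and hardening tensor $\mathbb H$ are (possibly $x$-dependent, measurable) linear maps on symmetric matrices that are symmetric with respect to the Frobenius product, uniformly bounded and uniformly elliptic. $\boldsymbol\sigma(\mathbf u,\boldsymbol p)=\mathbb C(\boldsymbol\varepsilon(\mathbf u)-\boldsymbol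 p)$ and $a((\mathbf u,\boldsymbol p),(\mathbf v,\boldsymbol q))=(\boldsymbol\sigma(\mathbf u,\boldsymbol p),\boldsymbol\varepsilon(\mathbf v)-\boldsymbol q)_{0,\Omega}+(\mathbb H\boldsymbol p,\boldsymbol q)_{0,\Omega}$, which is continuous and elliptic on $V\times Q$. The yield stress $\sigma_y>0$ is a constant, $\psi(\boldsymbol q)=(\sigma_y,|\boldsymbol q|_F)_{0,\Omega}$, $\Lambda=\{\boldsymbol\mu\in Q:|\boldsymbol\mu|_F\le\sigma_y\text{ a.e. in }\Omega\}$. For given $\mathbf f\in V^*$, $\mathbf g\in H^{-1/2}(\Gamma_N,\mathbb R^d)$ (dual of the trace space $V|_{\Gamma_N}$), $\ell(\mathbf v)=\langle\mathbf f,\mathbf v\rangle+\langle\mathbf g,\mathbf v\rangle_{\Gamma_N}$. Mixed problem: $(\mathbf u,\boldsymbol p,\boldsymbol\lambda)\in V\times Q\times\Lambda$ is the (unique) triple with $a((\mathbf u,\boldsymbol p),(\mathbf v,\boldsymbol q))+(\boldsymbol\lambda,\boldsymbol q)_{0,\Omega}=\ell(\mathbf v)$ for all $(\mathbf v,\boldsymbol q)\in V\times Q$ and $(\boldsymbol\mu-\boldsymbol\lambda,\boldsymbol p)_{0,\Omega}\le0$ for all $\boldsymbol\mu\in\Lambda$. Auxiliary problem associated with $\boldsymbol\lambda_N\in Q$: $(\mathbf u^*,\boldsymbol p^* )\in V\times Q$ is the (unique) pair with $a((\mathbf u^*,\boldsymbol p^* ),(\mathbf v,\boldsymbol q))=\ell(\mathbf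 v)-(\boldsymbol\lambda_N,\boldsymbol q)_{0,\Omega}$ for all $(\mathbf v,\boldsymbol q)\in V\times Q$. The constant $c$ may depend on the data $\Omega,\Gamma_D,\mathbb C,\mathbb H,\sigma_y,\mathbf f,\mathbf g$. *)

theory Defs
  imports "HOL-Analysis.Analysis"
begin

section \<open>Polyhedral Lipschitz domains and surface measure\<close>

text \<open>Near each boundary point the set is, up to the choice of an ``upward'' unit vector \<open>e\<close>,
  the strict epigraph of a Lipschitz function of the component orthogonal to \<open>e\<close>.\<close>

definition lipschitz_boundary :: "'a::euclidean_space set \<Rightarrow> bool" where
  "lipschitz_boundary \<Omega> \<longleftrightarrow>
     (\<forall>x\<in>frontier \<Omega>. \<exists>r>0. \<exists>e \<gamma> L. norm e = 1 \<and> L-lipschitz_on UNIV (\<gamma> :: 'a \<Rightarrow> real) \<and>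
        \<Omega> \<inter> ball x r = {y \<in> ball x r. \<gamma> (y - (y \<bullet> e) *\<^sub>R e) < y \<bullet> e})"

definition polyhedral_lipschitz_domain :: "'a::euclidean_space set \<Rightarrow> bool" where
  "polyhedral_lipschitz_domain \<Omega> \<longleftrightarrow>
     open \<Omega> \<and> connected \<Omega> \<and> bounded \<Omega> \<and> \<Omega> \<noteq> {} \<and>
     (\<exists>\<F>. finite \<F> \<and> (\<forall>P\<in>\<F>. polytope P) \<and> frontier \<Omega> = \<Union>\<F>) \<and>
     lipschitz_boundary \<Omega>"

definition hausdorff_premeasure :: "nat \<Rightarrow> real \<Rightarrow> 'a::euclidean_space set \<Rightarrow> ennreal" where
  "hausdorff_premeasure k \<delta> A =
     (INF U \<in> {U :: nat \<Rightarrow> 'a set. A \<subseteq> (\<Union>i. U i) \<and> (\<forall>i. bounded (U i) \<and> diameter (U i) \<le> \<delta>)}.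
        \<Sum>i. ennreal (unit_ball_vol (real k) * (diameter (U i) / 2) ^ k))"

definition hausdorff_outer_measure :: "nat \<Rightarrow> 'a::euclidean_space set \<Rightarrow> ennreal" where
  "hausdorff_outer_measure k A = (SUP \<delta>\<in>{0<..}. hausdorff_premeasure k \<delta> A)"

text \<open>The \<open>(d-1)\<close>-dimensional Hausdorff measure on the Borel sets, normalised so that it is the
  usual surface measure. It is meant for \<open>d \<ge> 2\<close> only (for exponent 0 the empty covering sets
  would be counted).\<close>

definition surface_measure :: "'a::euclidean_space measure" where
  "surface_measure =
     measure_of UNIV (sets borel) (hausdorff_outer_measure (DIM('a) - 1))"

definition surface_measure_on :: "'a::euclidean_space set \<Rightarrow> 'a measure" where
  "surface_measure_on G = restrict_space surface_measure G"


section \<open>Square-integrable functions\<close>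

text \<open>Elements of function spaces are functions; equality in the space is equality almost
  everywhere. On matrices \<^typ>\<open>real^'n^'n\<close> the library inner product and norm are the Frobenius
  product and norm.\<close>

definition L2_space :: "'a measure \<Rightarrow> ('a \<Rightarrow> 'b::euclidean_space) set" where
  "L2_space M = {f. f \<in> borel_measurable M \<and> integrable M (\<lambda>x. (norm (f x))\<^sup>2)}"

definition L2_inner :: "'a measure \<Rightarrow> ('a \<Rightarrow> 'b::euclidean_space) \<Rightarrow> ('a \<Rightarrow> 'b) \<Rightarrow> real" where
  "L2_inner M f g = (\<integral>x. f x \<bullet> g x \<partial>M)"

definition L2_norm :: "'a measure \<Rightarrow> ('a \<Rightarrow> 'b::euclidean_space) \<Rightarrow> real" where
  "L2_norm M f = sqrt (\<integral>x. (norm (f x))\<^sup>2 \<partial>M)"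


section \<open>The Sobolev space of vector fields\<close>

definition partial_deriv :: "'n::finite \<Rightarrow> (real^'n \<Rightarrow> real) \<Rightarrow> real^'n \<Rightarrow> real" where
  "partial_deriv j f x = frechet_derivative f (at x) (axis j 1)"

primrec C_k :: "nat \<Rightarrow> (real^'n::finite \<Rightarrow> real) \<Rightarrow> bool" where
  "C_k 0 f \<longleftrightarrow> continuous_on UNIV f"
| "C_k (Suc k) f \<longleftrightarrow> (\<forall>x. f differentiable (at x)) \<and> (\<forall>j. C_k k (partial_deriv j f))"

definition C_inf :: "(real^'n::finite \<Rightarrow> real) \<Rightarrow> bool" where
  "C_inf f \<longleftrightarrow> (\<forall>k. C_k k f)"

definition test_functions :: "(real^'n::finite) set \<Rightarrow> (real^'n \<Rightarrow> real) set" where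
  "test_functions \<Omega> =
     {\<phi>. C_inf \<phi> \<and> compact (closure {x. \<phi> x \<noteq> 0}) \<and> closure {x. \<phi> x \<noteq> 0} \<subseteq> \<Omega>}"

text \<open>The entry \<open>G x $ i $ j\<close> is the weak partial derivative of the component \<open>v $ i\<close> in
  direction \<open>j\<close>.\<close>

definition weak_gradient ::
    "(real^'n::finite) set \<Rightarrow> (real^'n \<Rightarrow> real^'n) \<Rightarrow> (real^'n \<Rightarrow> real^'n^'n) \<Rightarrow> bool" where
  "weak_gradient \<Omega> v G \<longleftrightarrow>
     (\<forall>\<phi>\<in>test_functions \<Omega>. \<forall>i j.
        (\<integral>x. v x $ i * partial_deriv j \<phi> x \<partial>(lebesgue_on \<Omega>)) =
        - (\<integral>x. G x $ i $ j * \<phi> x \<partial>(lebesgue_on \<Omega>)))"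

definition H1 :: "(real^'n::finite) set \<Rightarrow> (real^'n \<Rightarrow> real^'n) set" where
  "H1 \<Omega> = {v \<in> L2_space (lebesgue_on \<Omega>). \<exists>G\<in>L2_space (lebesgue_on \<Omega>). weak_gradient \<Omega> v G}"

text \<open>The weak gradient of an \<open>H1\<close> field, unique up to null sets.\<close>

definition grad :: "(real^'n::finite) set \<Rightarrow> (real^'n \<Rightarrow> real^'n) \<Rightarrow> real^'n \<Rightarrow> real^'n^'n" where
  "grad \<Omega> v = (SOME G. G \<in> L2_space (lebesgue_on \<Omega>) \<and> weak_gradient \<Omega> v G)"

definition sym_grad :: "(real^'n::finite) set \<Rightarrow> (real^'n \<Rightarrow> real^'n) \<Rightarrow> real^'n \<Rightarrow> real^'n^'n" where
  "sym_grad \<Omega> v x = (1/2) *\<^sub>R (grad \<Omega> v x + transpose (grad \<Omega> v x))"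

definition norm1 :: "(real^'n::finite) set \<Rightarrow> (real^'n \<Rightarrow> real^'n) \<Rightarrow> real" where
  "norm1 \<Omega> v =
     sqrt ((L2_norm (lebesgue_on \<Omega>) v)\<^sup>2 + (L2_norm (lebesgue_on \<Omega>) (sym_grad \<Omega> v))\<^sup>2)"


section \<open>Boundary traces\<close>

text \<open>The trace operator is the continuous extension, from the \<open>H1\<close> norm to the \<open>L2\<close> norm of
  the boundary, of the restriction map on functions that are smooth up to the boundary.\<close>

definition has_trace ::
    "(real^'n::finite) set \<Rightarrow> (real^'n \<Rightarrow> real^'n) \<Rightarrow> (real^'n \<Rightarrow> real^'n) \<Rightarrow> bool" where
  "has_trace \<Omega> v w \<longleftrightarrow>
     v \<in> H1 \<Omega> \<and> w \<in> L2_space (surface_measure_on (frontier \<Omega>)) \<and>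
     (\<exists>\<phi> :: nat \<Rightarrow> real^'n \<Rightarrow> real^'n.
        (\<forall>k i. C_inf (\<lambda>x. \<phi> k x $ i)) \<and>
        (\<lambda>k. L2_norm (lebesgue_on \<Omega>) (\<lambda>x. \<phi> k x - v x)) \<longlonglongrightarrow> 0 \<and>
        (\<lambda>k. L2_norm (lebesgue_on \<Omega>) (grad \<Omega> (\<lambda>x. \<phi> k x - v x))) \<longlonglongrightarrow> 0 \<and>
        (\<lambda>k. L2_norm (surface_measure_on (frontier \<Omega>)) (\<lambda>x. \<phi> k x - w x)) \<longlonglongrightarrow> 0)"

definition boundary_trace ::
    "(real^'n::finite) set \<Rightarrow> (real^'n \<Rightarrow> real^'n) \<Rightarrow> real^'n \<Rightarrow> real^'n" where
  "boundary_trace \<Omega> v = (SOME w. has_trace \<Omega> v w)"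

text \<open>\<open>w\<close> represents the restriction of the trace of \<open>v\<close> to the boundary part \<open>G\<close>.\<close>

definition has_trace_on ::
    "(real^'n::finite) set \<Rightarrow> (real^'n) set \<Rightarrow> (real^'n \<Rightarrow> real^'n) \<Rightarrow> (real^'n \<Rightarrow> real^'n) \<Rightarrow> bool"
  where
  "has_trace_on \<Omega> G v w \<longleftrightarrow>
     (\<exists>w'. has_trace \<Omega> v w' \<and> (AE x in surface_measure_on G. w x = w' x))"

definition V_space :: "(real^'n::finite) set \<Rightarrow> (real^'n) set \<Rightarrow> (real^'n \<Rightarrow> real^'n) set" where
  "V_space \<Omega> \<Gamma>\<^sub>D = {v \<in> H1 \<Omega>. has_trace_on \<Omega> \<Gamma>\<^sub>D v (\<lambda>_. 0)}"

definition neumann_boundary :: "(real^'n::finite) set \<Rightarrow> (real^'n) set \<Rightarrow> (real^'n) set" where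
  "neumann_boundary \<Omega> \<Gamma>\<^sub>D = frontier \<Omega> - \<Gamma>\<^sub>D"

definition trace_space :: "(real^'n::finite) set \<Rightarrow> (real^'n) set \<Rightarrow> (real^'n \<Rightarrow> real^'n) set" where
  "trace_space \<Omega> \<Gamma>\<^sub>D =
     {w. \<exists>v\<in>V_space \<Omega> \<Gamma>\<^sub>D. has_trace_on \<Omega> (neumann_boundary \<Omega> \<Gamma>\<^sub>D) v w}"

text \<open>Quotient norm on the trace space.\<close>

definition trace_norm ::
    "(real^'n::finite) set \<Rightarrow> (real^'n) set \<Rightarrow> (real^'n \<Rightarrow> real^'n) \<Rightarrow> real" where
  "trace_norm \<Omega> \<Gamma>\<^sub>D w =
     Inf {norm1 \<Omega> v | v. v \<in> V_space \<Omega> \<Gamma>\<^sub>D \<and> has_trace_on \<Omega> (neumann_boundary \<Omega> \<Gamma>\<^sub>D) v w}"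

text \<open>Bounded linear functionals on a function space \<open>S\<close> with norm \<open>N\<close>. Boundedness forces
  the same value on functions that are identified in \<open>S\<close>.\<close>

definition dual_space ::
    "('a \<Rightarrow> 'b::real_vector) set \<Rightarrow> (('a \<Rightarrow> 'b) \<Rightarrow> real) \<Rightarrow> (('a \<Rightarrow> 'b) \<Rightarrow> real) set" where
  "dual_space S N =
     {F. (\<forall>v\<in>S. \<forall>w\<in>S. F (\<lambda>x. v x + w x) = F v + F w) \<and>
         (\<forall>v\<in>S. \<forall>r. F (\<lambda>x. r *\<^sub>R v x) = r * F v) \<and>
         (\<exists>K. \<forall>v\<in>S. \<bar>F v\<bar> \<le> K * N v)}"


section \<open>Elastoplasticity with linear kinematic hardening\<close>

definition sym_matrices :: "(real^'n::finite^'n) set" where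
  "sym_matrices = {A. A = transpose A}"

definition dev_sym_matrices :: "(real^'n::finite^'n) set" where
  "dev_sym_matrices = {A. A = transpose A \<and> trace A = 0}"

definition Q_space :: "(real^'n::finite) set \<Rightarrow> (real^'n \<Rightarrow> real^'n^'n) set" where
  "Q_space \<Omega> = {q \<in> L2_space (lebesgue_on \<Omega>). AE x in lebesgue_on \<Omega>. q x \<in> dev_sym_matrices}"

definition VQ_norm ::
    "(real^'n::finite) set \<Rightarrow> (real^'n \<Rightarrow> real^'n) \<Rightarrow> (real^'n \<Rightarrow> real^'n^'n) \<Rightarrow> real" where
  "VQ_norm \<Omega> v q = sqrt ((norm1 \<Omega> v)\<^sup>2 + (L2_norm (lebesgue_on \<Omega>) q)\<^sup>2)"

definition material_tensor ::
    "(real^'n::finite) set \<Rightarrow> (real^'n \<Rightarrow> real^'n^'n \<Rightarrow> real^'n^'n) \<Rightarrow> bool" where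
  "material_tensor \<Omega> T \<longleftrightarrow>
     (\<forall>A\<in>sym_matrices. (\<lambda>x. T x A) \<in> borel_measurable (lebesgue_on \<Omega>)) \<and>
     (AE x in lebesgue_on \<Omega>.
        (\<forall>A\<in>sym_matrices. T x A \<in> sym_matrices) \<and>
        (\<forall>A\<in>sym_matrices. \<forall>B\<in>sym_matrices. T x (A + B) = T x A + T x B) \<and>
        (\<forall>A\<in>sym_matrices. \<forall>r. T x (r *\<^sub>R A) = r *\<^sub>R T x A) \<and>
        (\<forall>A\<in>sym_matrices. \<forall>B\<in>sym_matrices. T x A \<bullet> B = A \<bullet> T x B)) \<and>
     (\<exists>K. AE x in lebesgue_on \<Omega>. \<forall>A\<in>sym_matrices. norm (T x A) \<le> K * norm A) \<and>
     (\<exists>m>0. AE x in lebesgue_on \<Omega>. \<forall>A\<in>sym_matrices. m * (norm A)\<^sup>2 \<le> T x A \<bullet> A)"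

definition stress ::
    "(real^'n::finite) set \<Rightarrow> (real^'n \<Rightarrow> real^'n^'n \<Rightarrow> real^'n^'n) \<Rightarrow>
     (real^'n \<Rightarrow> real^'n) \<Rightarrow> (real^'n \<Rightarrow> real^'n^'n) \<Rightarrow> real^'n \<Rightarrow> real^'n^'n" where
  "stress \<Omega> \<CC> u p x = \<CC> x (sym_grad \<Omega> u x - p x)"

definition a_form ::
    "(real^'n::finite) set \<Rightarrow>
     (real^'n \<Rightarrow> real^'n^'n \<Rightarrow> real^'n^'n) \<Rightarrow> (real^'n \<Rightarrow> real^'n^'n \<Rightarrow> real^'n^'n) \<Rightarrow>
     (real^'n \<Rightarrow> real^'n) \<Rightarrow> (real^'n \<Rightarrow> real^'n^'n) \<Rightarrow>
     (real^'n \<Rightarrow> real^'n) \<Rightarrow> (real^'n \<Rightarrow> real^'n^'n) \<Rightarrow> real" where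
  "a_form \<Omega> \<CC> \<HH> u p v q =
     L2_inner (lebesgue_on \<Omega>) (stress \<Omega> \<CC> u p) (\<lambda>x. sym_grad \<Omega> v x - q x) +
     L2_inner (lebesgue_on \<Omega>) (\<lambda>x. \<HH> x (p x)) q"

text \<open>On a Lipschitz domain with \<open>\<Gamma>\<^sub>D\<close> of positive measure this is a consequence of Korn's inequality.\<close>

definition a_elliptic ::
    "(real^'n::finite) set \<Rightarrow> (real^'n) set \<Rightarrow>
     (real^'n \<Rightarrow> real^'n^'n \<Rightarrow> real^'n^'n) \<Rightarrow> (real^'n \<Rightarrow> real^'n^'n \<Rightarrow> real^'n^'n) \<Rightarrow> bool" where
  "a_elliptic \<Omega> \<Gamma>\<^sub>D \<CC> \<HH> \<longleftrightarrow>
     (\<exists>\<alpha>>0. \<forall>v\<in>V_space \<Omega> \<Gamma>\<^sub>D. \<forall>q\<in>Q_space \<Omega>. \<alpha> * (VQ_norm \<Omega> v q)\<^sup>2 \<le> a_form \<Omega> \<CC> \<HH> v q v q)"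

definition load ::
    "(real^'n::finite) set \<Rightarrow> ((real^'n \<Rightarrow> real^'n) \<Rightarrow> real) \<Rightarrow> ((real^'n \<Rightarrow> real^'n) \<Rightarrow> real) \<Rightarrow>
     (real^'n \<Rightarrow> real^'n) \<Rightarrow> real" where
  "load \<Omega> f g v = f v + g (boundary_trace \<Omega> v)"

definition plastic_dissipation ::
    "(real^'n::finite) set \<Rightarrow> real \<Rightarrow> (real^'n \<Rightarrow> real^'n^'n) \<Rightarrow> real" where
  "plastic_dissipation \<Omega> \<sigma>\<^sub>y q = L2_inner (lebesgue_on \<Omega>) (\<lambda>_. \<sigma>\<^sub>y) (\<lambda>x. norm (q x))"

definition Lambda_set :: "(real^'n::finite) set \<Rightarrow> real \<Rightarrow> (real^'n \<Rightarrow> real^'n^'n) set" where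
  "Lambda_set \<Omega> \<sigma>\<^sub>y = {\<mu> \<in> Q_space \<Omega>. AE x in lebesgue_on \<Omega>. norm (\<mu> x) \<le> \<sigma>\<^sub>y}"

text \<open>The multiplier (usually written as lambda, a reserved symbol) is called \<open>l\<close>.\<close>

definition mixed_solution ::
    "(real^'n::finite) set \<Rightarrow> (real^'n) set \<Rightarrow>
     (real^'n \<Rightarrow> real^'n^'n \<Rightarrow> real^'n^'n) \<Rightarrow> (real^'n \<Rightarrow> real^'n^'n \<Rightarrow> real^'n^'n) \<Rightarrow> real \<Rightarrow>
     ((real^'n \<Rightarrow> real^'n) \<Rightarrow> real) \<Rightarrow> ((real^'n \<Rightarrow> real^'n) \<Rightarrow> real) \<Rightarrow>
     (real^'n \<Rightarrow> real^'n) \<Rightarrow> (real^'n \<Rightarrow> real^'n^'n) \<Rightarrow> (real^'n \<Rightarrow> real^'n^'n) \<Rightarrow> bool" where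
  "mixed_solution \<Omega> \<Gamma>\<^sub>D \<CC> \<HH> \<sigma>\<^sub>y f g u p l \<longleftrightarrow>
     u \<in> V_space \<Omega> \<Gamma>\<^sub>D \<and> p \<in> Q_space \<Omega> \<and> l \<in> Lambda_set \<Omega> \<sigma>\<^sub>y \<and>
     (\<forall>v\<in>V_space \<Omega> \<Gamma>\<^sub>D. \<forall>q\<in>Q_space \<Omega>.
        a_form \<Omega> \<CC> \<HH> u p v q + L2_inner (lebesgue_on \<Omega>) l q = load \<Omega> f g v) \<and>
     (\<forall>\<mu>\<in>Lambda_set \<Omega> \<sigma>\<^sub>y. L2_inner (lebesgue_on \<Omega>) (\<lambda>x. \<mu> x - l x) p \<le> 0)"

definition auxiliary_solution ::
    "(real^'n::finite) set \<Rightarrow> (real^'n) set \<Rightarrow>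
     (real^'n \<Rightarrow> real^'n^'n \<Rightarrow> real^'n^'n) \<Rightarrow> (real^'n \<Rightarrow> real^'n^'n \<Rightarrow> real^'n^'n) \<Rightarrow>
     ((real^'n \<Rightarrow> real^'n) \<Rightarrow> real) \<Rightarrow> ((real^'n \<Rightarrow> real^'n) \<Rightarrow> real) \<Rightarrow>
     (real^'n \<Rightarrow> real^'n^'n) \<Rightarrow> (real^'n \<Rightarrow> real^'n) \<Rightarrow> (real^'n \<Rightarrow> real^'n^'n) \<Rightarrow> bool" where
  "auxiliary_solution \<Omega> \<Gamma>\<^sub>D \<CC> \<HH> f g l\<^sub>N u p \<longleftrightarrow>
     u \<in> V_space \<Omega> \<Gamma>\<^sub>D \<and> p \<in> Q_space \<Omega> \<and>
     (\<forall>v\<in>V_space \<Omega> \<Gamma>\<^sub>D. \<forall>q\<in>Q_space \<Omega>.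
        a_form \<Omega> \<CC> \<HH> u p v q = load \<Omega> f g v - L2_inner (lebesgue_on \<Omega>) l\<^sub>N q)"

definition error_E ::
    "(real^'n::finite) set \<Rightarrow> real \<Rightarrow> (real^'n \<Rightarrow> real^'n^'n) \<Rightarrow> (real^'n \<Rightarrow> real^'n^'n) \<Rightarrow>
     (real^'n \<Rightarrow> real^'n^'n) \<Rightarrow> real" where
  "error_E \<Omega> \<sigma>\<^sub>y p\<^sub>N l\<^sub>N \<mu> =
     (L2_norm (lebesgue_on \<Omega>) (\<lambda>x. \<mu> x - l\<^sub>N x))\<^sup>2 + plastic_dissipation \<Omega> \<sigma>\<^sub>y p\<^sub>N
       - L2_inner (lebesgue_on \<Omega>) \<mu> p\<^sub>N"

text \<open>Where the argument vanishes the value is \<open>0\<close>, whatever \<open>\<sigma>\<^sub>y / 0\<close> is.\<close>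

definition mu_star ::
    "real \<Rightarrow> (real^'n::finite \<Rightarrow> real^'n^'n) \<Rightarrow> (real^'n \<Rightarrow> real^'n^'n) \<Rightarrow> real^'n \<Rightarrow> real^'n^'n" where
  "mu_star \<sigma>\<^sub>y p\<^sub>N l\<^sub>N x =
     (let m = l\<^sub>N x + (1/2) *\<^sub>R p\<^sub>N x in min 1 (\<sigma>\<^sub>y / norm m) *\<^sub>R m)"

end

theory Submission
  imports Defs
begin

text \<open>
  The mathematical heart is a short variational argument. Subtracting the auxiliary from the mixed
  problem removes the load, and what remains is driven by \<open>\<lambda> - \<lambda>\<^sub>N\<close> alone: with \<open>e\<close> the difference of
  the two solution pairs, \<open>a(e, e) = (\<lambda> - \<lambda>\<^sub>N, p' - p)\<close>, so ellipticity and Cauchy-Schwarz bound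
  \<open>e\<close> by \<open>\<alpha>\<inverse> \<parallel>\<lambda> - \<lambda>\<^sub>N\<parallel>\<close> (\<open>auxiliary_error_le\<close>), and the triangle inequality bounds the first
  summand on the left-hand side. For the second summand, completing the square shows that
  \<open>|\<mu> - \<lambda>\<^sub>N|\<^sup>2 - \<mu> : p\<^sub>N\<close> differs from \<open>|\<mu> - (\<lambda>\<^sub>N + p\<^sub>N / 2)|\<^sup>2\<close> by a quantity independent of \<open>\<mu>\<close>,
  so the radial projection \<open>\<mu>\<^sup>*\<close> minimises the functional \<open>E\<close> over \<open>\<Lambda>\<close>
  (\<open>error_E_mu_star_le\<close>); in particular \<open>E(\<mu>\<^sup>*) \<le> E(\<lambda>)\<close>. Finally the variational inequality says
  \<open>\<psi>(p) \<le> (\<lambda>, p)\<close>, and replacing \<open>p\<close> by \<open>p\<^sub>N\<close> costs at most \<open>2 \<sigma>\<^sub>y |\<Omega>|\<^bsup>1/2\<^esup> \<parallel>p - p\<^sub>N\<parallel>\<close>, because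
  both terms are Lipschitz with constant \<open>\<sigma>\<^sub>y\<close> in the \<open>L\<^sup>1\<close> norm (\<open>dissipation_gap_le\<close>). This is
  where the unsquared norm in the estimate comes from.

  The argument uses tacitly that \<open>V\<close> is closed under differences and that the gradient is additive.
  Gradients are chosen by a choice operator, so additivity amounts to uniqueness of weak gradients
  up to null sets, which is the fundamental lemma of the calculus of variations
  (\<open>fundamental_lemma_calculus_of_variations\<close>): indicators of boxes are bounded pointwise limits of
  test functions, hence a function orthogonal to all test functions has zero mean over all small
  boxes, and Lebesgue differentiation makes it vanish. Traces are limits of smooth functions in the
  \<open>L\<^sup>2\<close> norm of the boundary. Differences of such limits obey the triangle inequality only if the
  smooth functions are square-integrable on the boundary, that is, if the boundary has finite
  surface measure. It does, because it is a finite union of polytopes without interior points, each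
  of which lies in a hyperplane and can be covered economically by small cells
  (\<open>hausdorff_hyperplane_finite\<close>). Smooth functions must also have a weak gradient, which is
  integration by parts.
\<close>

section \<open>Differentiability classes\<close>

lemma partial_deriv_eq:
  assumes "(f has_derivative D) (at x)"
  shows "partial_deriv j f x = D (axis j 1)"
  using frechet_derivative_at[OF assms] by (simp add: partial_deriv_def)

lemma partial_deriv_const [simp]: "partial_deriv j (\<lambda>_. c) x = 0"
  by (subst partial_deriv_eq[where D="\<lambda>_. 0"]) (auto intro: derivative_eq_intros)

lemma partial_deriv_add:
  assumes "f differentiable (at x)" "g differentiable (at x)"
  shows "partial_deriv j (\<lambda>x. f x + g x) x = partial_deriv j f x + partial_deriv j g x"
  using assms unfolding frechet_derivative_works partial_deriv_def
  by (subst frechet_derivative_at[symmetric, OF has_derivative_add]) auto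

lemma partial_deriv_mult:
  assumes "f differentiable (at x)" "g differentiable (at x)"
  shows "partial_deriv j (\<lambda>x. f x * g x) x = f x * partial_deriv j g x + partial_deriv j f x * g x"
  using assms unfolding frechet_derivative_works partial_deriv_def
  by (subst frechet_derivative_at[symmetric, OF has_derivative_mult]) auto

lemma C_k_Suc_imp_C_k: "C_k (Suc k) f \<Longrightarrow> C_k k f"
proof (induction k arbitrary: f)
  case 0
  then show ?case
    by (auto simp: continuous_on_eq_continuous_at differentiable_imp_continuous_within)
next
  case (Suc k)
  then show ?case by (metis C_k.simps(2))
qed

lemma C_k_const: "C_k k (\<lambda>_. c)"
proof (induction k arbitrary: c)
  case (Suc k)
  have "partial_deriv j (\<lambda>_::real^'a. c) = (\<lambda>_. 0)" for j by auto
  then show ?case using Suc by auto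
qed auto

lemma C_k_add: "C_k k f \<Longrightarrow> C_k k g \<Longrightarrow> C_k k (\<lambda>x. f x + g x)"
proof (induction k arbitrary: f g)
  case 0 then show ?case by (auto intro: continuous_intros)
next
  case (Suc k)
  then have "partial_deriv j (\<lambda>x. f x + g x) = (\<lambda>x. partial_deriv j f x + partial_deriv j g x)" for j
    by (auto simp: partial_deriv_add)
  with Suc show ?case by auto
qed

lemma C_k_mult: "C_k k f \<Longrightarrow> C_k k g \<Longrightarrow> C_k k (\<lambda>x. f x * g x)"
proof (induction k arbitrary: f g)
  case 0 then show ?case by (auto intro: continuous_intros)
next
  case (Suc k)
  then have "partial_deriv j (\<lambda>x. f x * g x)
      = (\<lambda>x. f x * partial_deriv j g x + partial_deriv j f x * g x)" for j
    by (auto simp: partial_deriv_mult)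
  with Suc C_k_Suc_imp_C_k[of k f] C_k_Suc_imp_C_k[of k g] show ?case by (auto intro: C_k_add)
qed

lemma C_k_diff: "C_k k f \<Longrightarrow> C_k k g \<Longrightarrow> C_k k (\<lambda>x. f x - g x)"
  using C_k_add[OF _ C_k_mult[OF C_k_const[of k "-1"]]] by fastforce

lemma C_k_prod: "finite I \<Longrightarrow> (\<And>i. i \<in> I \<Longrightarrow> C_k k (f i)) \<Longrightarrow> C_k k (\<lambda>x. \<Prod>i\<in>I. f i x)"
  by (induction I rule: finite_induct) (auto intro: C_k_const C_k_mult)

lemma C_inf_continuous: "C_inf f \<Longrightarrow> continuous_on UNIV f"
  unfolding C_inf_def using C_k.simps(1) by blast

lemma C_inf_differentiable: "C_inf f \<Longrightarrow> f differentiable (at x)"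
  unfolding C_inf_def using C_k.simps(2)[of 0] by blast

lemma C_inf_partial_deriv: "C_inf f \<Longrightarrow> C_inf (partial_deriv j f)"
  unfolding C_inf_def using C_k.simps(2) by blast

lemma C_inf_diff: "C_inf f \<Longrightarrow> C_inf g \<Longrightarrow> C_inf (\<lambda>x. f x - g x)"
  by (simp add: C_inf_def C_k_diff)

lemma C_inf_mult: "C_inf f \<Longrightarrow> C_inf g \<Longrightarrow> C_inf (\<lambda>x. f x * g x)"
  by (simp add: C_inf_def C_k_mult)

section \<open>Smooth bump functions\<close>

text \<open>For \<open>P = 1\<close> this is the standard smooth function that is flat at \<open>0\<close>. Carrying a polynomial
  factor in \<open>1 / t\<close> along makes the family closed under differentiation, so that smoothness of all
  its members follows by one induction.\<close>

definition flat_exp :: "real poly \<Rightarrow> real \<Rightarrow> real" where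
  "flat_exp P t = (if t > 0 then poly P (1 / t) * exp (- 1 / t) else 0)"

lemma poly_over_exp_tendsto_0: "((\<lambda>s. poly P s * exp (- s)) \<longlongrightarrow> (0::real)) at_top"
proof -
  have "((\<lambda>s. \<Sum>i\<le>degree P. coeff P i * (s ^ i / exp s)) \<longlongrightarrow> (\<Sum>i\<le>degree P. coeff P i * 0)) at_top"
    by (intro tendsto_intros tendsto_power_div_exp_0)
  then show ?thesis
    by (simp add: poly_altdef exp_minus divide_inverse sum_distrib_right mult.assoc)
qed

text \<open>This limit is the derivative at \<open>0\<close>: with \<open>s = 1 / t\<close> the quotient becomes a polynomial in
  \<open>s\<close> times \<open>exp (- s)\<close>.\<close>

lemma flat_exp_tendsto_0: "((\<lambda>t. flat_exp P t / t) \<longlongrightarrow> 0) (at 0)"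
proof -
  have "((\<lambda>t. poly ([:0,1:] * P) (inverse t) * exp (- inverse t)) \<longlongrightarrow> 0) (at_right (0::real))"
    using filterlim_compose[OF poly_over_exp_tendsto_0 filterlim_inverse_at_top_right] .
  moreover have "eventually (\<lambda>t. poly ([:0,1:] * P) (inverse t) * exp (- inverse t) = flat_exp P t / t) (at_right 0)"
    by (rule eventually_at_right_less[THEN eventually_mono]) (simp add: flat_exp_def field_simps)
  ultimately have "((\<lambda>t. flat_exp P t / t) \<longlongrightarrow> 0) (at_right 0)"
    by (rule Lim_transform_eventually)
  moreover have "eventually (\<lambda>t. 0 = flat_exp P t / t) (at_left (0::real))"
    by (auto simp: eventually_at_filter flat_exp_def)
  then have "((\<lambda>t. flat_exp P t / t) \<longlongrightarrow> 0) (at_left 0)"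
    by (rule Lim_transform_eventually[OF tendsto_const])
  ultimately show ?thesis by (simp add: filterlim_split_at)
qed

text \<open>By the product and chain rules, \<open>P\<close> is replaced by \<open>s\<^sup>2 (P - P')\<close> in the variable \<open>s = 1 / t\<close>.\<close>

lemma DERIV_flat_exp: "(flat_exp P has_real_derivative flat_exp ([:0,0,1:] * (P - pderiv P)) t) (at t)"
proof -
  consider "t > 0" | "t < 0" | "t = 0" by linarith
  then show ?thesis
  proof cases
    case 1
    have "((\<lambda>t. poly P (1/t) * exp (- 1 / t)) has_real_derivative
        flat_exp ([:0,0,1:] * (P - pderiv P)) t) (at t)"
      using 1 unfolding flat_exp_def
      by (auto intro!: derivative_eq_intros poly_DERIV[THEN DERIV_chain2] simp: power2_eq_square field_simps)
    then show ?thesis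
      by (rule has_field_derivative_transform_within_open[of _ _ _ "{0<..}"]) (use 1 in \<open>auto simp: flat_exp_def\<close>)
  next
    case 2
    have "((\<lambda>t. 0) has_real_derivative flat_exp ([:0,0,1:] * (P - pderiv P)) t) (at t)"
      using 2 by (auto simp: flat_exp_def)
    then show ?thesis
      by (rule has_field_derivative_transform_within_open[of _ _ _ "{..<0}"]) (use 2 in \<open>auto simp: flat_exp_def\<close>)
  next
    case 3
    then show ?thesis
      using flat_exp_tendsto_0[of P] by (simp add: DERIV_def flat_exp_def)
  qed
qed

lemma flat_exp_smult: "c * flat_exp P t = flat_exp (smult c P) t"
  by (simp add: flat_exp_def)

lemma C_k_flat_exp_affine: "C_k k (\<lambda>x::real^'n. flat_exp P (c * x $ i + d))"
proof (induction k arbitrary: P)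
  case 0
  have "continuous_on UNIV (flat_exp P)"
    using DERIV_flat_exp DERIV_continuous_on by blast
  moreover have "continuous_on UNIV (\<lambda>x::real^'n. c * x $ i + d)"
    by (intro continuous_intros)
  ultimately show ?case
    using continuous_on_compose2[of UNIV "flat_exp P" UNIV "\<lambda>x::real^'n. c * x $ i + d"] by simp
next
  case (Suc k)
  let ?P = "[:0,0,1:] * (P - pderiv P)"
  have D: "((\<lambda>x::real^'n. flat_exp P (c * x $ i + d)) has_derivative
        (\<lambda>h. c * h $ i * flat_exp ?P (c * x $ i + d))) (at x)" for x
  proof -
    have "((\<lambda>x::real^'n. c * x $ i + d) has_derivative (\<lambda>h. c * h $ i)) (at x)"
      by (auto intro!: derivative_eq_intros bounded_linear.has_derivative[OF bounded_linear_vec_nth])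
    then show ?thesis 
      using DERIV_flat_exp[THEN DERIV_compose_FDERIV] by blast
  qed
  have "partial_deriv j (\<lambda>x::real^'n. flat_exp P (c * x $ i + d))
      = (\<lambda>x. flat_exp (smult (c * axis j 1 $ i) ?P) (c * x $ i + d))" for j
    by (rule ext, subst partial_deriv_eq[OF D]) (simp only: flat_exp_smult)
  then show ?case using Suc D by (auto simp: differentiable_def)
qed

text \<open>Inside the box each factor is \<open>exp (- 1 / (k d))\<close>, where \<open>d\<close> is the distance of \<open>x\<close> to one
  face, and tends to \<open>1\<close> as \<open>k\<close> grows; outside some factor is zero.\<close>

definition box_bump :: "real^'n \<Rightarrow> real^'n \<Rightarrow> nat \<Rightarrow> real^'n \<Rightarrow> real" where
  "box_bump a b k x =
     (\<Prod>i\<in>UNIV. flat_exp 1 (real k * x $ i + - (real k * a $ i)) * flat_exp 1 ((- real k) * x $ i + real k * b $ i))"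

lemma flat_exp_1_bounds: "0 \<le> flat_exp 1 t" "flat_exp 1 t \<le> 1"
  by (auto simp: flat_exp_def)

lemma box_bump_bounds: "0 \<le> box_bump a b k x" "box_bump a b k x \<le> 1"
  unfolding box_bump_def by (auto intro!: prod_nonneg prod_le_1 mult_nonneg_nonneg mult_le_one flat_exp_1_bounds)

lemma box_bump_eq_0: "x \<notin> box a b \<Longrightarrow> box_bump a b k x = 0"
proof -
  assume "x \<notin> box a b"
  then obtain i where "x $ i \<le> a $ i \<or> b $ i \<le> x $ i"
    by (auto simp: mem_box_cart not_less)
  then have "flat_exp 1 (real k * x $ i + - (real k * a $ i)) * flat_exp 1 ((- real k) * x $ i + real k * b $ i) = 0"
    using mult_left_mono[of "x $ i" "a $ i" "real k"] mult_left_mono[of "b $ i" "x $ i" "real k"]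
    by (auto simp: flat_exp_def)
  then show ?thesis
    unfolding box_bump_def by (intro prod_zero) auto
qed
   
lemma box_bump_tendsto:
  fixes x :: "real^'n"
  shows "(\<lambda>k. box_bump a b k x) \<longlonglongrightarrow> indicator (box a b) x"
proof (cases "x \<in> box a b")
  case True
  have *: "(\<lambda>k. flat_exp 1 (real k * t)) \<longlonglongrightarrow> 1" if "t > 0" for t
  proof -
    have "(\<lambda>k. exp (- (1 / t) * (1 / real k))) \<longlonglongrightarrow> exp (- (1 / t) * 0)"
      by (intro tendsto_intros lim_1_over_n)
    then have "(\<lambda>k. exp (- (1 / t) * (1 / real k))) \<longlonglongrightarrow> 1" by simp
    moreover have "eventually (\<lambda>k. exp (- (1 / t) * (1 / real k)) = flat_exp 1 (real k * t)) sequentially"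
      using eventually_gt_at_top[of 0] by eventually_elim (use that in \<open>simp add: flat_exp_def mult.commute\<close>)
    ultimately show ?thesis by (rule Lim_transform_eventually)
  qed
  have "(\<lambda>k. \<Prod>i\<in>UNIV. flat_exp 1 (real k * (x $ i - a $ i)) * flat_exp 1 (real k * (b $ i - x $ i)))
      \<longlonglongrightarrow> (\<Prod>i\<in>(UNIV::'n set). 1 * 1)"
    by (intro tendsto_prod tendsto_mult *) (use True in \<open>auto simp: mem_box_cart\<close>)
  then show ?thesis using True by (simp add: box_bump_def algebra_simps)
next
  case False
  then show ?thesis by (simp add: box_bump_eq_0)
qed

lemma box_bump_test_function:
  assumes "cbox a b \<subseteq> \<Omega>"
  shows "box_bump a b k \<in> test_functions \<Omega>"
proof -
  have "C_inf (box_bump a b k)"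
    unfolding C_inf_def box_bump_def by (intro allI C_k_prod C_k_mult C_k_flat_exp_affine) auto
  moreover have sub: "closure {x. box_bump a b k x \<noteq> 0} \<subseteq> cbox a b"
    using box_bump_eq_0[of _ a b k] box_subset_cbox by (intro closure_minimal) fastforce+
  moreover have "compact (closure {x. box_bump a b k x \<noteq> 0})"
    using sub by (meson bounded_cbox bounded_subset compact_eq_bounded_closed closed_closure)
  ultimately show ?thesis using assms by (auto simp: test_functions_def)
qed

section \<open>Square-integrable functions\<close>

lemma L2_norm_nonneg [simp]: "0 \<le> L2_norm M f"
  by (simp add: L2_norm_def)

lemma L2_norm_squared: "(L2_norm M f)\<^sup>2 = (\<integral>x. (norm (f x))\<^sup>2 \<partial>M)"
  by (simp add: L2_norm_def integral_nonneg)

lemma L2_norm_cong_AE: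
  "AE x in M. f x = g x \<Longrightarrow> f \<in> borel_measurable M \<Longrightarrow> g \<in> borel_measurable M
   \<Longrightarrow> L2_norm M f = L2_norm M g"
  unfolding L2_norm_def by (rule arg_cong[where f=sqrt], rule integral_cong_AE) auto

lemma L2_spaceD:
  assumes "f \<in> L2_space M"
  shows "f \<in> borel_measurable M" "integrable M (\<lambda>x. (norm (f x))\<^sup>2)"
  using assms by (auto simp: L2_space_def)

lemma L2_space_bound:
  fixes g :: "'a \<Rightarrow> 'b::euclidean_space"
  assumes "integrable M h" "g \<in> borel_measurable M" "AE x in M. (norm (g x))\<^sup>2 \<le> h x"
  shows "g \<in> L2_space M"
  unfolding L2_space_def
  using assms by (auto intro!: Bochner_Integration.integrable_bound[OF assms(1)])

lemma norm_add_squared_le: "(norm (a + b))\<^sup>2 \<le> 2 * (norm a)\<^sup>2 + 2 * (norm (b::'a::real_inner))\<^sup>2"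
proof -
  have "0 \<le> (norm (a - b))\<^sup>2" by simp
  then show ?thesis by (simp add: power2_norm_eq_inner inner_simps inner_commute)
qed

lemma L2_space_add:
  assumes "f \<in> L2_space M" "g \<in> L2_space M"
  shows "(\<lambda>x. f x + g x) \<in> L2_space M"
proof (rule L2_space_bound[where h="\<lambda>x. 2 * (norm (f x))\<^sup>2 + 2 * (norm (g x))\<^sup>2"])
  show "AE x in M. (norm (f x + g x))\<^sup>2 \<le> 2 * (norm (f x))\<^sup>2 + 2 * (norm (g x))\<^sup>2"
    using norm_add_squared_le by blast
qed (use L2_spaceD[OF assms(1)] L2_spaceD[OF assms(2)] in auto)

lemma L2_space_scaleR:
  "f \<in> L2_space M \<Longrightarrow> (\<lambda>x. c *\<^sub>R f x) \<in> L2_space M"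
  by (auto simp: L2_space_def power_mult_distrib)

lemma L2_space_diff:
  assumes "f \<in> L2_space M" "g \<in> L2_space M"
  shows "(\<lambda>x. f x - g x) \<in> L2_space M"
  using L2_space_add[OF assms(1) L2_space_scaleR[OF assms(2), of "-1"]] by simp

lemma L2_space_bounded:
  assumes "finite_measure M" "f \<in> borel_measurable M" "AE x in M. norm (f x) \<le> B"
  shows "f \<in> L2_space M"
proof (rule L2_space_bound[where h="\<lambda>_. B\<^sup>2"])
  interpret finite_measure M by fact
  show "integrable M (\<lambda>_. B\<^sup>2)" by simp
  show "AE x in M. (norm (f x))\<^sup>2 \<le> B\<^sup>2"
    using assms(3) by eventually_elim (simp add: power_mono)
qed fact

lemma L2_integrable_inner:
  assumes "f \<in> L2_space M" "g \<in> L2_space M"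
  shows "integrable M (\<lambda>x. f x \<bullet> g x)"
proof (rule Bochner_Integration.integrable_bound)
  show "integrable M (\<lambda>x. (norm (f x))\<^sup>2 + (norm (g x))\<^sup>2)"
    using L2_spaceD(2)[OF assms(1)] L2_spaceD(2)[OF assms(2)] by simp
  show "(\<lambda>x. f x \<bullet> g x) \<in> borel_measurable M"
    using assms[THEN L2_spaceD(1)] by measurable
  show "AE x in M. norm (f x \<bullet> g x) \<le> norm ((norm (f x))\<^sup>2 + (norm (g x))\<^sup>2)"
  proof (intro AE_I2)
    fix x
    have "2 * (norm (f x) * norm (g x)) \<le> (norm (f x))\<^sup>2 + (norm (g x))\<^sup>2"
      using sum_squares_bound[of "norm (f x)" "norm (g x)"] by simp
    moreover have "0 \<le> norm (f x) * norm (g x)" by simp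
    ultimately show "norm (f x \<bullet> g x) \<le> norm ((norm (f x))\<^sup>2 + (norm (g x))\<^sup>2)"
      using Cauchy_Schwarz_ineq2[of "f x" "g x"] by simp
  qed
qed

lemma L2_integrable:
  assumes "finite_measure M" "f \<in> L2_space M"
  shows "integrable M f"
proof -
  interpret finite_measure M by fact
  have "integrable M (\<lambda>x. norm (f x))"
    by (rule square_integrable_imp_integrable) (use L2_spaceD[OF assms(2)] in simp_all)
  then show ?thesis
    using L2_spaceD(1)[OF assms(2)] by (metis integrable_norm_iff)
qed

lemma L2_norm_diff_squared:
  assumes "f \<in> L2_space M" "g \<in> L2_space M"
  shows "(L2_norm M (\<lambda>x. f x - t *\<^sub>R g x))\<^sup>2
    = (L2_norm M f)\<^sup>2 - 2 * t * L2_inner M f g + t\<^sup>2 * (L2_norm M g)\<^sup>2"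
proof -
  have "(norm (f x - t *\<^sub>R g x))\<^sup>2 = (norm (f x))\<^sup>2 - 2 * t * (f x \<bullet> g x) + t\<^sup>2 * (norm (g x))\<^sup>2" for x
    unfolding power2_norm_eq_inner
    by (simp add: inner_simps inner_commute power2_eq_square algebra_simps)
  then show ?thesis
    using assms[THEN L2_spaceD(2)] L2_integrable_inner[OF assms]
    by (simp add: L2_norm_squared L2_inner_def)
qed

lemma L2_Cauchy_Schwarz:
  assumes "f \<in> L2_space M" "g \<in> L2_space M"
  shows "\<bar>L2_inner M f g\<bar> \<le> L2_norm M f * L2_norm M g"
proof -
  define A B C where "A = (L2_norm M f)\<^sup>2" and "B = (L2_norm M g)\<^sup>2" and "C = L2_inner M f g"
  have nonneg: "0 \<le> A - 2 * t * C + t\<^sup>2 * B" for t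
    using L2_norm_diff_squared[OF assms, of t, symmetric] by (simp add: A_def B_def C_def)
  have "C\<^sup>2 \<le> A * B"
  proof (cases "B = 0")
    case True
    \<comment> \<open>An affine function of \<open>t\<close> that is bounded below is constant.\<close>
    have "C = 0"
    proof (rule ccontr)
      assume "C \<noteq> 0"
      then show False using nonneg[of "(A + 1) / (2 * C)"] True by simp
    qed
    then show ?thesis using True by simp
  next
    case False
    then have "B > 0" by (simp add: B_def)
    moreover have "2 * (C / B) * C = 2 * (C\<^sup>2 / B)" "(C / B)\<^sup>2 * B = C\<^sup>2 / B"
      using False by (simp_all add: power2_eq_square)
    ultimately have "C\<^sup>2 / B \<le> A" using nonneg[of "C / B"] by linarith
    then show ?thesis using \<open>B > 0\<close> by (simp only: pos_divide_le_eq)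
  qed
  then have "\<bar>C\<bar>\<^sup>2 \<le> (L2_norm M f * L2_norm M g)\<^sup>2"
    by (simp add: A_def B_def power_mult_distrib)
  then show ?thesis
    unfolding C_def by (rule power2_le_imp_le) simp
qed

lemma L2_norm_diff_le:
  assumes "f \<in> L2_space M" "g \<in> L2_space M"
  shows "L2_norm M (\<lambda>x. f x - g x) \<le> L2_norm M f + L2_norm M g"
proof (rule power2_le_imp_le)
  show "(L2_norm M (\<lambda>x. f x - g x))\<^sup>2 \<le> (L2_norm M f + L2_norm M g)\<^sup>2"
    using L2_norm_diff_squared[OF assms, of 1] L2_Cauchy_Schwarz[OF assms]
    by (simp add: power2_sum)
qed simp

lemma L2_norm_add_squared_le:
  assumes "f \<in> L2_space M" "g \<in> L2_space M"
  shows "(L2_norm M (\<lambda>x. f x + g x))\<^sup>2 \<le> 2 * (L2_norm M f)\<^sup>2 + 2 * (L2_norm M g)\<^sup>2"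
proof -
  have "(\<integral>x. (norm (f x + g x))\<^sup>2 \<partial>M) \<le> (\<integral>x. 2 * (norm (f x))\<^sup>2 + 2 * (norm (g x))\<^sup>2 \<partial>M)"
    using assms[THEN L2_spaceD(2)] L2_spaceD(2)[OF L2_space_add[OF assms]] norm_add_squared_le
    by (intro integral_mono) auto
  then show ?thesis
    using assms[THEN L2_spaceD(2)] by (simp add: L2_norm_squared)
qed

lemma L2_norm_tendsto_0_diff:
  assumes "(\<lambda>k. L2_norm M (f k)) \<longlonglongrightarrow> 0" "(\<lambda>k. L2_norm M (g k)) \<longlonglongrightarrow> 0"
    and "\<And>k. f k \<in> L2_space M" "\<And>k. g k \<in> L2_space M"
  shows "(\<lambda>k. L2_norm M (\<lambda>x. f k x - g k x)) \<longlonglongrightarrow> 0"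
proof (rule tendsto_sandwich[OF _ _ tendsto_const])
  show "(\<lambda>k. L2_norm M (f k) + L2_norm M (g k)) \<longlonglongrightarrow> 0"
    using tendsto_add[OF assms(1,2)] by simp
qed (auto intro!: always_eventually L2_norm_diff_le assms)

section \<open>Integration by parts\<close>

text \<open>The partial derivative is the bounded pointwise limit of difference quotients, and each
  difference quotient has integral zero by translation invariance of Lebesgue measure.\<close>

lemma integral_partial_deriv_compact_support:
  fixes h :: "real^'n \<Rightarrow> real"
  assumes diff: "\<And>x. h differentiable (at x)" and cont: "continuous_on UNIV (partial_deriv j h)"
    and supp: "compact (closure {x. h x \<noteq> 0})"
  shows "(\<integral>x. partial_deriv j h x \<partial>lborel) = 0"
proof -
  let ?D = "partial_deriv j h" and ?e = "axis j 1 :: real^'n"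
  define K where "K = closure {x. h x \<noteq> 0}"
  have K: "compact K"
    using supp unfolding K_def .
  have h0: "h x = 0" if "x \<notin> K" for x
    using that closure_subset[of "{x. h x \<noteq> 0}"] unfolding K_def by auto
  have contK: "continuous_on UNIV h"
    using diff by (simp add: continuous_on_eq_continuous_at differentiable_imp_continuous_within)
  then have [measurable]: "h \<in> borel_measurable borel"
    by (rule borel_measurable_continuous_onI)
  have dirderiv: "((\<lambda>s. h (x + s *\<^sub>R ?e)) has_real_derivative ?D (x + s *\<^sub>R ?e)) (at s)" for x s
  proof -
    let ?F = "frechet_derivative h (at (x + s *\<^sub>R ?e))"
    have F: "(h has_derivative ?F) (at (x + s *\<^sub>R ?e))"
      using diff frechet_derivative_works by blast
    have "((\<lambda>s. h (x + s *\<^sub>R ?e)) has_derivative (\<lambda>y. ?F (y *\<^sub>R ?e))) (at s)"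
      by (rule has_derivative_compose[where f="\<lambda>s. x + s *\<^sub>R ?e" and g=h])
        (use F in \<open>auto intro!: derivative_eq_intros\<close>)
    moreover have "?F (y *\<^sub>R ?e) = ?D (x + s *\<^sub>R ?e) * y" for y
      using linear_cmul[OF has_derivative_linear[OF F], of y ?e] by (simp add: partial_deriv_def)
    ultimately show ?thesis by (simp add: has_field_derivative_def)
  qed
  have D0: "?D x = 0" if "x \<notin> K" for x
  proof -
    have "open (- K)" using K compact_imp_closed by auto
    then have "(h has_derivative (\<lambda>_. 0)) (at x)"
      by (rule has_derivative_transform_within_open[OF has_derivative_const[of 0]]) (use that h0 in auto)
    then show ?thesis by (simp add: partial_deriv_eq)
  qed
  obtain M where M: "\<And>x. \<bar>?D x\<bar> \<le> M"
  proof -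
    have "bounded (?D ` K)"
      using K cont by (meson compact_continuous_image compact_imp_bounded continuous_on_subset subset_UNIV)
    then obtain M where "\<forall>x\<in>K. \<bar>?D x\<bar> \<le> M" by (auto simp: bounded_iff)
    then have "\<bar>?D x\<bar> \<le> max M 0" for x using D0[of x] by (cases "x \<in> K") fastforce+
    then show ?thesis by (rule that)
  qed
  obtain R where R: "\<And>x. x \<in> K \<Longrightarrow> norm x \<le> R"
    using compact_imp_bounded[OF K] by (auto simp: bounded_iff)
  define t :: "nat \<Rightarrow> real" where "t n = 1 / (real n + 1)" for n
  have t: "0 < t n" "t n \<le> 1" for n by (auto simp: t_def)
  define q where "q n x = (h (x + t n *\<^sub>R ?e) - h x) / t n" for n x
  have int_h: "integrable lborel h"
  proof -
    have "integrable lborel (\<lambda>x. indicator K x *\<^sub>R h x)"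
      by (rule borel_integrable_compact[OF K]) (use contK continuous_on_subset in auto)
    moreover have "(\<lambda>x. indicator K x *\<^sub>R h x) = h" by (auto simp: fun_eq_iff indicator_def h0)
    ultimately show ?thesis by simp
  qed
  have shift: "(\<integral>x. h (x + c) \<partial>lborel) = (\<integral>x. h x \<partial>lborel)" "integrable lborel (\<lambda>x. h (x + c))" for c
  proof -
    have "(\<integral>x. h x \<partial>lborel) = (\<integral>x. h x \<partial>distr lborel borel ((+) c))"
      by (simp add: lborel_distr_plus)
    then show "(\<integral>x. h (x + c) \<partial>lborel) = (\<integral>x. h x \<partial>lborel)"
      by (simp add: integral_distr add.commute)
    have "integrable (distr lborel borel ((+) c)) h"
      using int_h by (simp add: lborel_distr_plus)
    then show "integrable lborel (\<lambda>x. h (x + c))"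
      by (simp add: integrable_distr_eq add.commute)
  qed
  have "(\<integral>x. q n x \<partial>lborel) = 0" for n
    unfolding q_def using shift int_h by simp
  moreover have "(\<lambda>n. \<integral>x. q n x \<partial>lborel) \<longlonglongrightarrow> (\<integral>x. ?D x \<partial>lborel)"
  proof (rule integral_dominated_convergence[where w="\<lambda>x. indicator (cball 0 (R + 1)) x * M"])
    show "?D \<in> borel_measurable lborel"
      using cont by (simp add: borel_measurable_continuous_onI)
    show "q n \<in> borel_measurable lborel" for n
      unfolding q_def by measurable
    \<comment> \<open>Shifts by at most \<open>1\<close> keep the quotients supported in the ball of radius \<open>R + 1\<close>.\<close>
    show "integrable lborel (\<lambda>x::real^'n. indicator (cball 0 (R + 1)) x * M)"
      using emeasure_lborel_cball_finite by (intro integrable_mult_left integrable_real_indicator) auto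
    show "AE x in lborel. (\<lambda>n. q n x) \<longlonglongrightarrow> ?D x"
    proof (intro AE_I2)
      fix x
      have "((\<lambda>s. (h (x + s *\<^sub>R ?e) - h x) / s) \<longlongrightarrow> ?D x) (at 0)"
        using dirderiv[of x 0] by (simp add: DERIV_def)
      moreover have "filterlim t (at 0) sequentially"
        unfolding filterlim_at t_def using LIMSEQ_inverse_real_of_nat by (simp add: inverse_eq_divide add.commute)
      ultimately show "(\<lambda>n. q n x) \<longlonglongrightarrow> ?D x"
        unfolding q_def by (rule filterlim_compose)
    qed
    show "AE x in lborel. norm (q n x) \<le> indicator (cball 0 (R + 1)) x * M" for n
    proof (intro AE_I2)
      fix x
      show "norm (q n x) \<le> indicator (cball 0 (R + 1)) x * M"
      proof (cases "norm x \<le> R + 1")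
        case True
        obtain s where "h (x + t n *\<^sub>R ?e) - h (x + 0 *\<^sub>R ?e) = (t n - 0) * ?D (x + s *\<^sub>R ?e)"
          using MVT2[OF t(1)[of n] dirderiv[of x]] by auto
        then have "q n x = ?D (x + s *\<^sub>R ?e)" using t[of n] by (simp add: q_def)
        then show ?thesis using True M by (simp add: indicator_def)
      next
        case False
        have "norm (t n *\<^sub>R ?e) \<le> 1" using t[of n] by simp
        then have "norm (x + t n *\<^sub>R ?e) > R" using False norm_diff_ineq[of x "t n *\<^sub>R ?e"] by linarith
        moreover have "norm x > R" using False by linarith
        ultimately have "h (x + t n *\<^sub>R ?e) = 0" "h x = 0" using R h0 by (metis not_le)+
        then show ?thesis using False by (simp add: q_def)
      qed
    qed
  qed
  ultimately show ?thesis by (simp add: LIMSEQ_const_iff)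
qed

lemma test_functionD:
  assumes "\<phi> \<in> test_functions \<Omega>"
  shows "C_inf \<phi>" "compact (closure {x. \<phi> x \<noteq> 0})" "x \<notin> \<Omega> \<Longrightarrow> \<phi> x = 0"
  using assms closure_subset[of "{x. \<phi> x \<noteq> 0}"] unfolding test_functions_def by auto

lemma test_function_partial_deriv:
  assumes "\<phi> \<in> test_functions \<Omega>"
  shows "partial_deriv j \<phi> \<in> test_functions \<Omega>"
proof -
  let ?K = "closure {x. \<phi> x \<noteq> 0}"
  have "partial_deriv j \<phi> x = 0" if "x \<notin> ?K" for x
  proof -
    have "open (- ?K)" by auto
    then have "(\<phi> has_derivative (\<lambda>_. 0)) (at x)"
      by (rule has_derivative_transform_within_open[OF has_derivative_const[of 0]])
        (use that closure_subset[of "{x. \<phi> x \<noteq> 0}"] in auto)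
    then show ?thesis by (simp add: partial_deriv_eq)
  qed
  then have "closure {x. partial_deriv j \<phi> x \<noteq> 0} \<subseteq> ?K"
    by (intro closure_minimal) auto
  moreover from this have "compact (closure {x. partial_deriv j \<phi> x \<noteq> 0})"
    using test_functionD(2)[OF assms] by (meson bounded_subset compact_eq_bounded_closed closed_closure)
  ultimately show ?thesis
    using assms C_inf_partial_deriv unfolding test_functions_def by blast
qed

lemma C_inf_bounded_on:
  assumes "C_inf \<phi>" "bounded S"
  obtains B where "\<And>x. x \<in> S \<Longrightarrow> \<bar>\<phi> x\<bar> \<le> B"
proof -
  have "bounded (\<phi> ` closure S)"
    using C_inf_continuous[OF assms(1)] assms(2)
    by (meson compact_closure compact_continuous_image compact_imp_bounded continuous_on_subset subset_UNIV)
  then obtain B where "\<forall>y\<in>\<phi> ` closure S. norm y \<le> B"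
    by (auto simp: bounded_iff)
  then show ?thesis
    using that[of B] closure_subset[of S] by auto
qed

lemma C_inf_measurable:
  assumes "C_inf \<phi>" "open \<Omega>"
  shows "\<phi> \<in> borel_measurable (lebesgue_on \<Omega>)"
  using assms(2)
  by (intro continuous_imp_measurable_on_sets_lebesgue continuous_on_subset[OF C_inf_continuous[OF assms(1)]]) auto

lemma finite_measure_lebesgue_on_open:
  "open \<Omega> \<Longrightarrow> bounded \<Omega> \<Longrightarrow> finite_measure (lebesgue_on \<Omega>)"
  by (simp add: finite_measure_lebesgue_on lmeasurable_open)

lemma C_inf_mult_integrable:
  assumes "open \<Omega>" "bounded \<Omega>" "integrable (lebesgue_on \<Omega>) (f :: real^'n \<Rightarrow> real)" "C_inf \<phi>"
  shows "integrable (lebesgue_on \<Omega>) (\<lambda>x. f x * \<phi> x)"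
proof -
  obtain B where B: "\<And>x. x \<in> \<Omega> \<Longrightarrow> \<bar>\<phi> x\<bar> \<le> B" using C_inf_bounded_on assms by blast
  show ?thesis
  proof (rule Bochner_Integration.integrable_bound[OF integrable_mult_left[OF assms(3), of B]])
    show "(\<lambda>x. f x * \<phi> x) \<in> borel_measurable (lebesgue_on \<Omega>)"
      using assms(3) C_inf_measurable[OF assms(4,1)] by measurable
    show "AE x in lebesgue_on \<Omega>. norm (f x * \<phi> x) \<le> norm (f x * B)"
      by (rule AE_I2) (use B in \<open>fastforce simp: abs_mult intro!: mult_left_mono\<close>)
  qed
qed

lemma C_inf_integrable:
  assumes "open \<Omega>" "bounded \<Omega>" "C_inf \<phi>"
  shows "integrable (lebesgue_on \<Omega>) \<phi>"
proof -
  interpret finite_measure "lebesgue_on \<Omega>"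
    by (rule finite_measure_lebesgue_on_open) fact+
  show ?thesis using C_inf_mult_integrable[OF assms(1,2) _ assms(3), of "\<lambda>_. 1"] by simp
qed

lemma integral_lebesgue_on_eq_lborel:
  assumes "open \<Omega>" "f \<in> borel_measurable borel" "\<And>x. x \<notin> \<Omega> \<Longrightarrow> f x = 0"
  shows "(\<integral>x. f x \<partial>lebesgue_on \<Omega>) = (\<integral>x. (f x :: real) \<partial>lborel)"
proof -
  have "(\<integral>x. f x \<partial>lebesgue_on \<Omega>) = (\<integral>x. (if x \<in> \<Omega> then f x else 0) \<partial>lebesgue)"
    using assms(1) by (intro Lebesgue_Measure.integral_restrict_UNIV[symmetric]) auto
  also have "(\<lambda>x. if x \<in> \<Omega> then f x else 0) = f" using assms(3) by auto
  finally show ?thesis using assms(2) by (simp add: integral_completion)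
qed

lemma integration_by_parts:
  fixes \<phi> \<psi> :: "real^'n \<Rightarrow> real"
  assumes "open \<Omega>" "bounded \<Omega>" "C_inf \<phi>" "\<psi> \<in> test_functions \<Omega>"
  shows "(\<integral>x. \<phi> x * partial_deriv j \<psi> x \<partial>lebesgue_on \<Omega>)
       = - (\<integral>x. partial_deriv j \<phi> x * \<psi> x \<partial>lebesgue_on \<Omega>)"
proof -
  let ?h = "\<lambda>x. \<phi> x * \<psi> x"
  have \<psi>: "C_inf \<psi>" using assms(4) by (rule test_functionD)
  have h: "C_inf ?h" using assms(3) \<psi> by (rule C_inf_mult)
  have "closure {x. ?h x \<noteq> 0} \<subseteq> closure {x. \<psi> x \<noteq> 0}" by (intro closure_mono) auto
  then have "compact (closure {x. ?h x \<noteq> 0})"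
    using test_functionD(2)[OF assms(4)] by (meson bounded_subset compact_eq_bounded_closed closed_closure)
  then have "0 = (\<integral>x. partial_deriv j ?h x \<partial>lborel)"
    using h by (simp add: integral_partial_deriv_compact_support C_inf_continuous C_inf_differentiable C_inf_partial_deriv)
  also have "\<dots> = (\<integral>x. partial_deriv j ?h x \<partial>lebesgue_on \<Omega>)"
  proof (rule integral_lebesgue_on_eq_lborel[symmetric])
    show "partial_deriv j ?h \<in> borel_measurable borel"
      using h by (intro borel_measurable_continuous_onI C_inf_continuous C_inf_partial_deriv)
    show "partial_deriv j ?h x = 0" if "x \<notin> \<Omega>" for x
      using test_functionD(3)[OF assms(4) that] test_functionD(3)[OF test_function_partial_deriv[OF assms(4)] that]
        assms(3) \<psi> by (simp add: partial_deriv_mult C_inf_differentiable)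
  qed fact
  also have "\<dots> = (\<integral>x. \<phi> x * partial_deriv j \<psi> x + partial_deriv j \<phi> x * \<psi> x \<partial>lebesgue_on \<Omega>)"
    using assms(3) \<psi> by (simp add: partial_deriv_mult C_inf_differentiable)
  also have "\<dots> = (\<integral>x. \<phi> x * partial_deriv j \<psi> x \<partial>lebesgue_on \<Omega>) + (\<integral>x. partial_deriv j \<phi> x * \<psi> x \<partial>lebesgue_on \<Omega>)"
    using assms \<psi> by (intro Bochner_Integration.integral_add C_inf_integrable C_inf_mult C_inf_partial_deriv)
  finally show ?thesis by simp
qed

section \<open>Weak gradients\<close>

text \<open>Approximating the indicator of a box by bumps shows that \<open>f\<close> has mean zero on every box whose
  closure lies in \<open>\<Omega>\<close>. Almost every value of \<open>f\<close> is a limit of such means.\<close>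

lemma fundamental_lemma_calculus_of_variations:
  fixes f :: "real^'n \<Rightarrow> real"
  assumes "open \<Omega>" and int: "integrable (lebesgue_on \<Omega>) f"
    and zero: "\<And>\<phi>. \<phi> \<in> test_functions \<Omega> \<Longrightarrow> (\<integral>x. f x * \<phi> x \<partial>lebesgue_on \<Omega>) = 0"
  shows "AE x in lebesgue_on \<Omega>. f x = 0"
proof -
  define F where "F x = (if x \<in> \<Omega> then f x else 0)" for x
  have \<Omega>: "\<Omega> \<in> sets lebesgue" using assms(1) by auto
  have intF: "integrable lebesgue F"
    unfolding F_def using int \<Omega> by (simp add: Lebesgue_Measure.integrable_restrict_UNIV)
  have F_box: "integral (cbox a b) F = 0" if ab: "cbox a b \<subseteq> \<Omega>" for a b
  proof -
    have sub: "box a b \<subseteq> \<Omega>" using ab box_subset_cbox by blast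
    have "(\<lambda>k. \<integral>x. f x * box_bump a b k x \<partial>lebesgue_on \<Omega>)
        \<longlonglongrightarrow> (\<integral>x. f x * indicator (box a b) x \<partial>lebesgue_on \<Omega>)"
    proof (rule integral_dominated_convergence[where w="\<lambda>x. \<bar>f x\<bar>"])
      show "(\<lambda>x. f x * indicator (box a b) x) \<in> borel_measurable (lebesgue_on \<Omega>)"
        using int \<Omega> sub by (intro borel_measurable_times borel_measurable_indicator) (auto simp: sets_restrict_space_iff)
      show "(\<lambda>x. f x * box_bump a b k x) \<in> borel_measurable (lebesgue_on \<Omega>)" for k
        using int C_inf_measurable[OF test_functionD(1)[OF box_bump_test_function[OF ab]] assms(1)]
        by measurable
      show "AE x in lebesgue_on \<Omega>. (\<lambda>k. f x * box_bump a b k x) \<longlonglongrightarrow> f x * indicator (box a b) x"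
        by (intro AE_I2 tendsto_mult_left box_bump_tendsto)
      show "AE x in lebesgue_on \<Omega>. norm (f x * box_bump a b k x) \<le> \<bar>f x\<bar>" for k
        by (intro AE_I2) (simp add: abs_mult box_bump_bounds mult_left_le)
    qed (use int in auto)
    then have "(\<integral>x. f x * indicator (box a b) x \<partial>lebesgue_on \<Omega>) = 0"
      using zero box_bump_test_function[OF ab] by (simp add: LIMSEQ_const_iff)
    moreover have "(\<lambda>x. f x * indicator (box a b) x) = (\<lambda>x. if x \<in> box a b then f x else 0)"
      by auto
    ultimately have "(\<integral>x. f x \<partial>lebesgue_on (box a b)) = 0"
      using \<Omega> by (simp add: Lebesgue_Measure.integral_restrict[OF sub])
    also have "(\<integral>x. f x \<partial>lebesgue_on (box a b)) = (\<integral>x. F x \<partial>lebesgue_on (box a b))"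
      by (intro Bochner_Integration.integral_cong) (use sub in \<open>auto simp: F_def\<close>)
    also have "\<dots> = integral (box a b) F"
      using integrable_mult_indicator[OF _ intF, of "box a b"]
      by (intro lebesgue_integral_eq_integral) (simp_all add: integrable_restrict_space)
    finally show ?thesis by (simp add: integral_open_interval)
  qed
  have "F integrable_on cbox a b" for a b
    using intF integrable_on_lebesgue integrable_on_subcbox by blast
  then obtain N where N: "negligible N" and diff:
    "\<And>x e. \<lbrakk>x \<notin> N; 0 < e\<rbrakk> \<Longrightarrow> \<exists>d>0. \<forall>h. 0 < h \<and> h < d \<longrightarrow>
        norm (integral (cbox x (x + h *\<^sub>R One)) F /\<^sub>R h ^ DIM(real^'n) - F x) < e"
    using integrable_ccontinuous_explicit[of F] by metis
  have F0: "F x = 0" if x: "x \<in> \<Omega>" "x \<notin> N" for x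
  proof (rule ccontr)
    assume "F x \<noteq> 0"
    then obtain d where d: "d > 0" "\<And>h. 0 < h \<Longrightarrow> h < d \<Longrightarrow>
        norm (integral (cbox x (x + h *\<^sub>R One)) F /\<^sub>R h ^ DIM(real^'n) - F x) < norm (F x)"
      using diff[OF x(2), of "norm (F x)"] by auto
    obtain r where r: "r > 0" "cball x r \<subseteq> \<Omega>" using assms(1) x(1) open_contains_cball by blast
    \<comment> \<open>Small enough for the differentiation estimate and for the cube at \<open>x\<close> to stay inside \<open>\<Omega>\<close>.\<close>
    define h where "h = min (d / 2) (r / norm (One :: real^'n))"
    have One: "norm (One :: real^'n) > 0" by simp
    have h: "0 < h" "h < d" "h * norm (One :: real^'n) \<le> r"
      using d(1) r(1) One by (auto simp: h_def min_def field_simps)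
    have "cbox x (x + h *\<^sub>R One) \<subseteq> cball x r"
    proof
      fix y assume y: "y \<in> cbox x (x + h *\<^sub>R One)"
      have "norm (y - x) \<le> norm (h *\<^sub>R (One :: real^'n))"
        by (rule norm_le_componentwise) (use y h(1) in \<open>auto simp: mem_box inner_simps\<close>)
      then show "y \<in> cball x r" using h by (simp add: dist_norm norm_minus_commute)
    qed
    then have "integral (cbox x (x + h *\<^sub>R One)) F = 0" using r(2) by (intro F_box) auto
    then show False using d(2)[OF h(1,2)] by simp
  qed
  have "AE x in lebesgue. x \<notin> N" using N by (simp add: negligible_iff_null_sets AE_not_in)
  then have "AE x in lebesgue_on \<Omega>. x \<notin> N" using \<Omega> by (subst AE_restrict_space_iff) auto
  then show ?thesis
    by (rule lebesgue_on_mono) (use F0 in \<open>auto simp: F_def\<close>)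
qed

lemma L2_space_bounded_linear:
  assumes "f \<in> L2_space M" "bounded_linear T"
  shows "(\<lambda>x. T (f x)) \<in> L2_space M"
proof -
  obtain K where K: "\<And>y. norm (T y) \<le> norm y * K"
    using bounded_linear.bounded[OF assms(2)] by blast
  show ?thesis
  proof (rule L2_space_bound[where h="\<lambda>x. K\<^sup>2 * (norm (f x))\<^sup>2"])
    show "integrable M (\<lambda>x. K\<^sup>2 * (norm (f x))\<^sup>2)"
      using L2_spaceD(2)[OF assms(1)] by simp
    show "(\<lambda>x. T (f x)) \<in> borel_measurable M"
      using L2_spaceD(1)[OF assms(1)]
        borel_measurable_continuous_onI[OF linear_continuous_on[OF assms(2)]] by measurable
    show "AE x in M. (norm (T (f x)))\<^sup>2 \<le> K\<^sup>2 * (norm (f x))\<^sup>2"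
    proof (rule AE_I2)
      fix x
      have "(norm (T (f x)))\<^sup>2 \<le> (norm (f x) * K)\<^sup>2"
        by (rule power_mono[OF K]) simp
      then show "(norm (T (f x)))\<^sup>2 \<le> K\<^sup>2 * (norm (f x))\<^sup>2"
        by (simp add: power_mult_distrib mult.commute)
    qed
  qed
qed

lemma L2_component_mult_integrable:
  fixes v :: "real^'n \<Rightarrow> real^'m::finite"
  assumes "open \<Omega>" "bounded \<Omega>" "v \<in> L2_space (lebesgue_on \<Omega>)" "\<phi> \<in> test_functions \<Omega>"
  shows "integrable (lebesgue_on \<Omega>) (\<lambda>x. v x $ i * \<phi> x)"
  using assms
  by (intro C_inf_mult_integrable integrable_bounded_linear[OF bounded_linear_vec_nth] L2_integrable
      finite_measure_lebesgue_on_open test_functionD(1)[of \<phi> \<Omega>])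

lemma L2_row:
  fixes G :: "'a \<Rightarrow> real^'n::finite^'m::finite"
  shows "G \<in> L2_space M \<Longrightarrow> (\<lambda>x. G x $ i) \<in> L2_space M"
  by (rule L2_space_bounded_linear) (auto intro: bounded_linear_vec_nth)

text \<open>Splitting the two integrals needs integrability of all products with test functions; square
  integrability provides it because \<open>\<Omega>\<close> is bounded.\<close>

lemma weak_gradient_diff:
  assumes "open \<Omega>" "bounded \<Omega>"
    and L2: "v \<in> L2_space (lebesgue_on \<Omega>)" "w \<in> L2_space (lebesgue_on \<Omega>)"
      "G \<in> L2_space (lebesgue_on \<Omega>)" "H \<in> L2_space (lebesgue_on \<Omega>)"
    and "weak_gradient \<Omega> v G" "weak_gradient \<Omega> w H"
  shows "weak_gradient \<Omega> (\<lambda>x. v x - w x) (\<lambda>x. G x - H x)"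
  unfolding weak_gradient_def
proof (intro ballI allI)
  fix \<phi> i j assume \<phi>: "\<phi> \<in> test_functions \<Omega>"
  note I = L2_component_mult_integrable[OF assms(1,2)]
  note \<phi>' = test_function_partial_deriv[OF \<phi>, of j]
  show "(\<integral>x. (v x - w x) $ i * partial_deriv j \<phi> x \<partial>lebesgue_on \<Omega>)
      = - (\<integral>x. (G x - H x) $ i $ j * \<phi> x \<partial>lebesgue_on \<Omega>)"
    using assms(7,8) \<phi> unfolding weak_gradient_def
    by (simp add: left_diff_distrib I[OF L2(1) \<phi>'] I[OF L2(2) \<phi>'] I[OF L2_row[OF L2(3)] \<phi>] I[OF L2_row[OF L2(4)] \<phi>])
qed

lemma weak_gradient_unique:
  assumes "open \<Omega>" "bounded \<Omega>"
    and L2: "G \<in> L2_space (lebesgue_on \<Omega>)" "H \<in> L2_space (lebesgue_on \<Omega>)"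
    and "weak_gradient \<Omega> v G" "weak_gradient \<Omega> v H"
  shows "AE x in lebesgue_on \<Omega>. G x = H x"
proof -
  have fin: "finite_measure (lebesgue_on \<Omega>)"
    using assms(1,2) by (rule finite_measure_lebesgue_on_open)
  have "AE x in lebesgue_on \<Omega>. G x $ i $ j - H x $ i $ j = 0" for i j
  proof (rule fundamental_lemma_calculus_of_variations[OF assms(1)])
    note int = integrable_bounded_linear[OF bounded_linear_vec_nth L2_integrable[OF fin L2_row]]
    show "integrable (lebesgue_on \<Omega>) (\<lambda>x. G x $ i $ j - H x $ i $ j)"
      using L2 by (intro Bochner_Integration.integrable_diff int)
    fix \<phi> assume \<phi>: "\<phi> \<in> test_functions \<Omega>"
    note I = L2_component_mult_integrable[OF assms(1,2) L2_row \<phi>]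
    have "(\<integral>x. G x $ i $ j * \<phi> x \<partial>lebesgue_on \<Omega>) = (\<integral>x. H x $ i $ j * \<phi> x \<partial>lebesgue_on \<Omega>)"
      using bspec[OF assms(5)[unfolded weak_gradient_def] \<phi>, rule_format, of i j]
        bspec[OF assms(6)[unfolded weak_gradient_def] \<phi>, rule_format, of i j] by simp
    then show "(\<integral>x. (G x $ i $ j - H x $ i $ j) * \<phi> x \<partial>lebesgue_on \<Omega>) = 0"
      by (simp add: left_diff_distrib I L2)
  qed
  then have "AE x in lebesgue_on \<Omega>. \<forall>i j. G x $ i $ j - H x $ i $ j = 0"
    by (simp add: AE_all_countable)
  then show ?thesis by eventually_elim (simp add: vec_eq_iff)
qed

lemma H1D:
  assumes "v \<in> H1 \<Omega>"
  shows "v \<in> L2_space (lebesgue_on \<Omega>)" "grad \<Omega> v \<in> L2_space (lebesgue_on \<Omega>)"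
    "weak_gradient \<Omega> v (grad \<Omega> v)"
proof -
  show "v \<in> L2_space (lebesgue_on \<Omega>)" using assms by (simp add: H1_def)
  have "\<exists>G. G \<in> L2_space (lebesgue_on \<Omega>) \<and> weak_gradient \<Omega> v G" using assms by (auto simp: H1_def)
  from someI_ex[OF this] show "grad \<Omega> v \<in> L2_space (lebesgue_on \<Omega>)" "weak_gradient \<Omega> v (grad \<Omega> v)"
    by (simp_all add: grad_def)
qed

lemma H1_diff:
  assumes "open \<Omega>" "bounded \<Omega>" "v \<in> H1 \<Omega>" "w \<in> H1 \<Omega>"
  shows "(\<lambda>x. v x - w x) \<in> H1 \<Omega>"
  using weak_gradient_diff[OF assms(1,2) H1D(1)[OF assms(3)] H1D(1)[OF assms(4)]
      H1D(2)[OF assms(3)] H1D(2)[OF assms(4)] H1D(3)[OF assms(3)] H1D(3)[OF assms(4)]]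
    L2_space_diff[OF H1D(1)[OF assms(3)] H1D(1)[OF assms(4)]]
    L2_space_diff[OF H1D(2)[OF assms(3)] H1D(2)[OF assms(4)]]
  unfolding H1_def by blast

text \<open>Both sides are weak gradients of the same field, so this is uniqueness; it is what makes the
  choice in the definition of \<^const>\<open>grad\<close> harmless.\<close>

lemma grad_diff:
  assumes "open \<Omega>" "bounded \<Omega>" "v \<in> H1 \<Omega>" "w \<in> H1 \<Omega>"
  shows "AE x in lebesgue_on \<Omega>. grad \<Omega> (\<lambda>x. v x - w x) x = grad \<Omega> v x - grad \<Omega> w x"
proof -
  note vw = H1D[OF H1_diff[OF assms]] and v = H1D[OF assms(3)] and w = H1D[OF assms(4)]
  show ?thesis
    by (rule weak_gradient_unique[OF assms(1,2) vw(2) L2_space_diff[OF v(2) w(2)] vw(3)])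
      (rule weak_gradient_diff[OF assms(1,2) v(1) w(1) v(2) w(2) v(3) w(3)])
qed

lemma C_inf_vector_continuous:
  fixes \<phi> :: "real^'n \<Rightarrow> real^'m::finite"
  assumes "\<And>i. C_inf (\<lambda>x. \<phi> x $ i)"
  shows "continuous_on UNIV \<phi>"
proof -
  have "continuous_on UNIV (\<lambda>x. \<chi> i. \<phi> x $ i)"
    by (intro continuous_on_vec_lambda C_inf_continuous assms)
  then show ?thesis by simp
qed

lemma continuous_L2_lebesgue_on:
  fixes F :: "'a::euclidean_space \<Rightarrow> 'b::euclidean_space"
  assumes "open \<Omega>" "bounded \<Omega>" "continuous_on UNIV F"
  shows "F \<in> L2_space (lebesgue_on \<Omega>)"
proof -
  have "bounded (F ` closure \<Omega>)"
    using assms(2)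
    by (intro compact_imp_bounded compact_continuous_image continuous_on_subset[OF assms(3)]) auto
  then obtain B where B: "\<forall>x\<in>closure \<Omega>. norm (F x) \<le> B" by (auto simp: bounded_iff)
  show ?thesis
  proof (rule L2_space_bounded[OF finite_measure_lebesgue_on_open[OF assms(1,2)]])
    show "F \<in> borel_measurable (lebesgue_on \<Omega>)"
      using assms(1)
      by (intro continuous_imp_measurable_on_sets_lebesgue continuous_on_subset[OF assms(3)]) auto
    show "AE x in lebesgue_on \<Omega>. norm (F x) \<le> B"
      using B closure_subset[of \<Omega>] by (intro AE_I2) auto
  qed
qed

text \<open>By integration by parts the classical gradient is a weak gradient. Both the field and its
  gradient are bounded on the bounded set \<open>\<Omega>\<close>, since they are continuous on the whole space.\<close>

lemma smooth_in_H1: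
  assumes "open \<Omega>" "bounded \<Omega>" and \<phi>: "\<And>i. C_inf (\<lambda>x. \<phi> x $ i)"
  shows "\<phi> \<in> H1 \<Omega>"
proof -
  define G where "G x = (\<chi> i j. partial_deriv j (\<lambda>x. \<phi> x $ i) x)" for x
  have "continuous_on UNIV G"
    unfolding G_def by (intro continuous_on_vec_lambda C_inf_continuous C_inf_partial_deriv \<phi>)
  then have "G \<in> L2_space (lebesgue_on \<Omega>)"
    by (rule continuous_L2_lebesgue_on[OF assms(1,2)])
  moreover have "\<phi> \<in> L2_space (lebesgue_on \<Omega>)"
    by (rule continuous_L2_lebesgue_on[OF assms(1,2) C_inf_vector_continuous]) (rule \<phi>)
  moreover have "weak_gradient \<Omega> \<phi> G"
    unfolding weak_gradient_def G_def using integration_by_parts[OF assms(1,2) \<phi>] by simp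
  ultimately show ?thesis by (auto simp: H1_def)
qed

section \<open>Finiteness of the surface measure\<close>

lemma space_surface_measure [simp]: "space surface_measure = UNIV"
  by (simp add: surface_measure_def space_measure_of_conv)

lemma sets_surface_measure [simp, measurable_cong]: "sets surface_measure = sets borel"
  by (simp add: surface_measure_def sets_measure_of_conv sets.sigma_sets_eq[of borel, simplified])

text \<open>The measure built from a set function agrees with it on Borel sets if it is countably additive
  there, and is zero otherwise. The upper bound holds in both cases.\<close>

lemma emeasure_surface_measure_le:
  "emeasure surface_measure (A :: 'a::euclidean_space set) \<le> hausdorff_outer_measure (DIM('a) - 1) A"
  by (simp add: surface_measure_def emeasure_measure_of_conv)

text \<open>The definition uses countable covers, so a finite cover is padded with empty sets. These
  contribute nothing as the exponent is positive.\<close>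

lemma hausdorff_premeasure_finite_cover:
  fixes A :: "'a::euclidean_space set"
  assumes "finite I" "A \<subseteq> (\<Union>i\<in>I. U i)" "0 \<le> s" "s \<le> \<delta>" "0 < k"
    and U: "\<And>i. i \<in> I \<Longrightarrow> bounded (U i) \<and> diameter (U i) \<le> s"
  shows "hausdorff_premeasure k \<delta> A \<le> ennreal (real (card I) * (unit_ball_vol (real k) * (s / 2) ^ k))"
proof -
  obtain e where e: "bij_betw e {..<card I} I"
    using ex_bij_betw_nat_finite[OF assms(1)] by (auto simp: lessThan_atLeast0)
  define W where "W n = (if n < card I then U (e n) else {})" for n
  have eI: "e n \<in> I" if "n < card I" for n using e that by (auto simp: bij_betw_def)
  have W: "bounded (W n) \<and> diameter (W n) \<le> s" for n
    using U eI assms(3) by (simp add: W_def)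
  have AW: "A \<subseteq> (\<Union>n. W n)"
  proof
    fix x assume "x \<in> A"
    then obtain i where "i \<in> I" "x \<in> U i" using assms(2) by auto
    then have "i \<in> e ` {..<card I}" using e by (simp add: bij_betw_def)
    then obtain n where "n < card I" "e n = i" by auto
    then show "x \<in> (\<Union>n. W n)" using \<open>x \<in> U i\<close> by (auto simp: W_def intro!: exI[of _ n])
  qed
  have "hausdorff_premeasure k \<delta> A \<le> (\<Sum>n. ennreal (unit_ball_vol (real k) * (diameter (W n) / 2) ^ k))"
    unfolding hausdorff_premeasure_def
    by (intro INF_lower) (use AW W assms(4) in \<open>auto intro: order_trans\<close>)
  also have "\<dots> = (\<Sum>n<card I. ennreal (unit_ball_vol (real k) * (diameter (W n) / 2) ^ k))"
    by (rule suminf_finite) (use assms(5) in \<open>auto simp: W_def\<close>)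
  also have "\<dots> \<le> (\<Sum>n<card I. ennreal (unit_ball_vol (real k) * (s / 2) ^ k))"
    using W by (intro sum_mono ennreal_leI mult_left_mono power_mono divide_right_mono)
      (auto intro: diameter_ge_0)
  also have "\<dots> = ennreal (real (card I) * (unit_ball_vol (real k) * (s / 2) ^ k))"
    using assms(3) by (simp add: ennreal_mult ennreal_of_nat_eq_real_of_nat)
  finally show ?thesis .
qed

text \<open>A hyperplane is a Lipschitz graph over all coordinates but one, say \<open>i0\<close>. A bounded part of
  it is therefore covered by about \<open>N\<^sup>k\<close> cells of diameter of order \<open>1 / N\<close>, where
  \<open>k = DIM('a) - 1\<close>: the number of cells compensates for the \<open>k\<close>-th power of the diameter.\<close>

lemma hausdorff_hyperplane_finite:
  fixes A :: "'a::euclidean_space set"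
  assumes "bounded A" "a \<noteq> 0" "A \<subseteq> {x. a \<bullet> x = b}" "DIM('a) \<ge> 2"
  shows "hausdorff_outer_measure (DIM('a) - 1) A < \<infinity>"
proof -
  define k where "k = DIM('a) - 1"
  have k: "0 < k" using assms(4) by (simp add: k_def)
  obtain i0 where i0: "i0 \<in> Basis" "a \<bullet> i0 \<noteq> 0"
    using assms(2) euclidean_all_zero_iff by blast
  define B where "B = (Basis - {i0} :: 'a set)"
  have B: "finite B" "card B = k" "Basis = insert i0 B" "i0 \<notin> B"
    using i0(1) by (auto simp: B_def k_def card_Diff_singleton)
  obtain R where R: "R > 0" "\<And>x. x \<in> A \<Longrightarrow> norm x \<le> R"
    using assms(1) by (auto simp: bounded_pos)
  define L where "L = (\<Sum>i\<in>B. \<bar>a \<bullet> i\<bar>) / \<bar>a \<bullet> i0\<bar>"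
  define c where "c = L + real k"
  have "L \<ge> 0" by (auto simp: L_def intro!: divide_nonneg_nonneg sum_nonneg)
  then have c: "c > 0" using k by (simp add: c_def)
  \<comment> \<open>On the hyperplane the remaining coordinate is controlled by the others.\<close>
  have near: "norm (x - y) \<le> c * s"
    if "x \<in> A" "y \<in> A" and s: "\<And>i. i \<in> B \<Longrightarrow> \<bar>(x - y) \<bullet> i\<bar> \<le> s" for x y s
  proof -
    have "0 = a \<bullet> (x - y)" using that(1,2) assms(3) by (auto simp: inner_diff_right)
    also have "\<dots> = (\<Sum>i\<in>Basis. (a \<bullet> i) * ((x - y) \<bullet> i))" by (rule euclidean_inner)
    also have "\<dots> = (a \<bullet> i0) * ((x - y) \<bullet> i0) + (\<Sum>i\<in>B. (a \<bullet> i) * ((x - y) \<bullet> i))"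
      by (subst B(3), subst sum.insert) (use B in auto)
    finally have "\<bar>a \<bullet> i0\<bar> * \<bar>(x - y) \<bullet> i0\<bar> = \<bar>\<Sum>i\<in>B. (a \<bullet> i) * ((x - y) \<bullet> i)\<bar>"
      by (simp add: abs_mult[symmetric] eq_neg_iff_add_eq_0[symmetric])
    also have "\<dots> \<le> (\<Sum>i\<in>B. \<bar>a \<bullet> i\<bar> * s)"
      using s by (intro order_trans[OF sum_abs] sum_mono) (auto simp: abs_mult intro!: mult_left_mono)
    also have "\<dots> = \<bar>a \<bullet> i0\<bar> * (L * s)"
      using i0(2) by (simp add: L_def sum_distrib_right)
    finally have "\<bar>(x - y) \<bullet> i0\<bar> \<le> L * s" using i0(2) by simp
    moreover have "(\<Sum>i\<in>B. \<bar>(x - y) \<bullet> i\<bar>) \<le> real k * s"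
      using sum_bounded_above[of B "\<lambda>i. \<bar>(x - y) \<bullet> i\<bar>" s] s B(2) by simp
    moreover have "norm (x - y) \<le> \<bar>(x - y) \<bullet> i0\<bar> + (\<Sum>i\<in>B. \<bar>(x - y) \<bullet> i\<bar>)"
      using norm_le_l1[of "x - y"] sum.insert[OF B(1,4), of "\<lambda>i. \<bar>(x - y) \<bullet> i\<bar>"]
      unfolding B(3)[symmetric] by simp
    ultimately show ?thesis by (simp add: c_def algebra_simps)
  qed
  define C where "C = unit_ball_vol (real k) * (2 * c * R) ^ k"
  have "hausdorff_premeasure k \<delta> A \<le> ennreal C" if "\<delta> > 0" for \<delta>
  proof -
    \<comment> \<open>Fine enough for the cells, of diameter at most \<open>c * h\<close>, to be admissible at scale \<open>\<delta>\<close>.\<close>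
    obtain N :: nat where N: "2 * c * R / \<delta> < real N" using reals_Archimedean2 by blast
    have N0: "0 < real N" using N c R(1) that by (smt (verit) divide_pos_pos mult_pos_pos)
    define h where "h = 2 * R / real N"
    have h: "h > 0" "c * h \<le> \<delta>"
      using N N0 R(1) c that by (auto simp: h_def field_simps)
    \<comment> \<open>The right end \<open>x \<bullet> i = R\<close> has index \<open>N\<close>, so there are \<open>N + 1\<close> indices per coordinate.\<close>
    define I where "I = PiE B (\<lambda>_. {0..int N})"
    define U where "U j = {x \<in> A. \<forall>i\<in>B. \<lfloor>(x \<bullet> i + R) / h\<rfloor> = j i}" for j
    have cardI: "card I = (N + 1) ^ k" unfolding I_def using B(1,2) by (simp add: card_PiE nat_add_distrib)
    have "hausdorff_premeasure k \<delta> A \<le> ennreal (real (card I) * (unit_ball_vol (real k) * ((c * h) / 2) ^ k))"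
    proof (rule hausdorff_premeasure_finite_cover[where U=U])
      show "finite I" unfolding I_def using B(1) by (intro finite_PiE) auto
      show "A \<subseteq> (\<Union>j\<in>I. U j)"
      proof
        fix x assume x: "x \<in> A"
        define j where "j = restrict (\<lambda>i. \<lfloor>(x \<bullet> i + R) / h\<rfloor>) B"
        have "\<lfloor>(x \<bullet> i + R) / h\<rfloor> \<in> {0..int N}" if "i \<in> B" for i
        proof -
          have "\<bar>x \<bullet> i\<bar> \<le> R" using Basis_le_norm[of i x] R(2)[OF x] that by (auto simp: B_def)
          then have "0 \<le> x \<bullet> i + R" "x \<bullet> i + R \<le> 2 * R" by linarith+
          moreover have "2 * R / h = real N" using N0 R(1) by (simp add: h_def)
          ultimately have "0 \<le> (x \<bullet> i + R) / h" "(x \<bullet> i + R) / h \<le> real N"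
            using h(1) divide_right_mono[of "x \<bullet> i + R" "2 * R" h] by auto
          then show ?thesis using floor_mono[of "(x \<bullet> i + R) / h" "real N"] by simp
        qed
        then have "j \<in> I" by (auto simp: I_def j_def)
        moreover have "x \<in> U j" using x by (auto simp: U_def j_def)
        ultimately show "x \<in> (\<Union>j\<in>I. U j)" by blast
      qed
      show "bounded (U j) \<and> diameter (U j) \<le> c * h" for j
      proof
        show "bounded (U j)" using assms(1) by (rule bounded_subset) (auto simp: U_def)
        have "\<bar>(x - y) \<bullet> i\<bar> \<le> h" if "x \<in> U j" "y \<in> U j" "i \<in> B" for x y i
        proof -
          have "\<lfloor>(x \<bullet> i + R) / h\<rfloor> = \<lfloor>(y \<bullet> i + R) / h\<rfloor>" using that by (auto simp: U_def)
          then have "\<bar>(x \<bullet> i + R) / h - (y \<bullet> i + R) / h\<bar> \<le> 1" by linarith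
          then have "\<bar>((x - y) \<bullet> i) / h\<bar> \<le> 1" by (simp add: diff_divide_distrib[symmetric] inner_diff_left)
          then show ?thesis using h(1) by (simp add: abs_divide)
        qed
        then show "diameter (U j) \<le> c * h"
          using near c h(1) by (intro diameter_le) (auto simp: U_def)
      qed
    qed (use h c k in auto)
    also have "\<dots> \<le> ennreal C"
    proof (rule ennreal_leI)
      have "real (card I) * ((c * h) / 2) ^ k = ((real N + 1) * (c * h / 2)) ^ k"
        unfolding cardI by (simp add: power_mult_distrib[symmetric] add.commute)
      also have "(real N + 1) * (c * h / 2) = c * R * ((real N + 1) / real N)"
        using N0 by (simp add: h_def)
      also have "(c * R * ((real N + 1) / real N)) ^ k \<le> (c * R * 2) ^ k"
        using N0 c R(1) by (intro power_mono mult_left_mono) (auto simp: field_simps)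
      finally have "real (card I) * ((c * h) / 2) ^ k \<le> (2 * c * R) ^ k" by (simp add: mult_ac)
      from mult_left_mono[OF this, of "unit_ball_vol (real k)"]
      show "real (card I) * (unit_ball_vol (real k) * ((c * h) / 2) ^ k) \<le> C"
        by (simp add: C_def mult_ac)
    qed
    finally show ?thesis .
  qed
  then have "hausdorff_outer_measure k A \<le> ennreal C"
    unfolding hausdorff_outer_measure_def by (intro SUP_least) auto
  then show ?thesis unfolding k_def by (rule order.strict_trans1) simp
qed

lemma interior_frontier_open: "open S \<Longrightarrow> interior (frontier S) = {}"
  for S :: "'a::topological_space set"
proof -
  assume "open S"
  have "interior (frontier S) \<inter> S = {}"
    using \<open>open S\<close> interior_subset[of "frontier S"] by (auto simp: frontier_def interior_open)
  then have "interior (frontier S) \<inter> closure S = {}"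
    by (simp add: open_Int_closure_eq_empty)
  then show ?thesis
    using interior_subset[of "frontier S"] by (auto simp: frontier_def)
qed

text \<open>The boundary of an open set has no interior, so each of its finitely many polytopes lies in a
  hyperplane.\<close>

lemma surface_measure_frontier_finite:
  fixes \<Omega> :: "'a::euclidean_space set"
  assumes "polyhedral_lipschitz_domain \<Omega>" "DIM('a) \<ge> 2"
  shows "finite_measure (surface_measure_on (frontier \<Omega>))"
proof -
  obtain F where F: "finite F" "\<And>P. P \<in> F \<Longrightarrow> polytope P" "frontier \<Omega> = \<Union>F" and "open \<Omega>"
    using assms(1) unfolding polyhedral_lipschitz_domain_def by blast
  have int: "interior (frontier \<Omega>) = {}"
    using \<open>open \<Omega>\<close> by (rule interior_frontier_open)
  have P: "emeasure surface_measure P < \<infinity>" "P \<in> sets surface_measure" if "P \<in> F" for P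
  proof -
    have poly: "polytope P" using F(2) that .
    have "interior P = {}" using int interior_mono[of P "frontier \<Omega>"] F(3) that by blast
    then obtain a b where "a \<noteq> 0" "P \<subseteq> {x. a \<bullet> x = b}"
      using empty_interior_subset_hyperplane[OF polytope_imp_convex[OF poly]] by blast
    then have "hausdorff_outer_measure (DIM('a) - 1) P < \<infinity>"
      using hausdorff_hyperplane_finite polytope_imp_bounded[OF poly] assms(2) by blast
    then show "emeasure surface_measure P < \<infinity>"
      using emeasure_surface_measure_le order.strict_trans1 by blast
    show "P \<in> sets surface_measure" using polytope_imp_closed[OF poly] by auto
  qed
  have "emeasure surface_measure (\<Union>P\<in>F. P) \<le> (\<Sum>P\<in>F. emeasure surface_measure P)"
    using F(1) P(2) by (intro emeasure_subadditive_finite) auto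
  also have "\<dots> < \<infinity>" using F(1) P(1) by (auto simp: less_top)
  finally have "emeasure surface_measure (frontier \<Omega>) < \<infinity>" using F(3) by simp
  then have "emeasure (surface_measure_on (frontier \<Omega>)) (space (surface_measure_on (frontier \<Omega>))) \<noteq> \<infinity>"
    unfolding surface_measure_on_def
    by (subst emeasure_restrict_space) (auto simp: space_restrict_space)
  then show ?thesis by (rule finite_measureI)
qed

text \<open>Integrability matters because an integral that does not exist has the value zero, for which
  the triangle inequality between norms would fail.\<close>

lemma continuous_L2_surface:
  fixes F :: "'a::euclidean_space \<Rightarrow> 'b::euclidean_space"
  assumes "finite_measure (surface_measure_on (frontier \<Omega>))" "bounded \<Omega>" "continuous_on UNIV F"
  shows "F \<in> L2_space (surface_measure_on (frontier \<Omega>))"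
proof -
  have "bounded (F ` frontier \<Omega>)"
    by (intro compact_imp_bounded compact_continuous_image continuous_on_subset[OF assms(3)]
        compact_frontier_bounded[OF assms(2)]) auto
  then obtain B where B: "\<forall>x\<in>frontier \<Omega>. norm (F x) \<le> B" by (auto simp: bounded_iff)
  show ?thesis
  proof (rule L2_space_bounded[OF assms(1)])
    have "F \<in> borel_measurable surface_measure"
      using borel_measurable_continuous_onI[OF assms(3)] by (simp cong: measurable_cong_sets)
    then show "F \<in> borel_measurable (surface_measure_on (frontier \<Omega>))"
      unfolding surface_measure_on_def by (rule measurable_restrict_space1)
    show "AE x in surface_measure_on (frontier \<Omega>). norm (F x) \<le> B"
      using B by (intro AE_I2) (simp add: surface_measure_on_def space_restrict_space)
  qed
qed

section \<open>Traces and the space V\<close>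

text \<open>Differences of the approximating smooth fields approximate the difference in all three norms.\<close>

lemma has_trace_diff:
  assumes "open \<Omega>" "bounded \<Omega>" "finite_measure (surface_measure_on (frontier \<Omega>))"
    and "has_trace \<Omega> v w" "has_trace \<Omega> v' w'"
  shows "has_trace \<Omega> (\<lambda>x. v x - v' x) (\<lambda>x. w x - w' x)"
proof -
  let ?M = "lebesgue_on \<Omega>" and ?S = "surface_measure_on (frontier \<Omega>)"
  obtain \<phi> where v: "v \<in> H1 \<Omega>" "w \<in> L2_space ?S" and \<phi>: "\<And>k i. C_inf (\<lambda>x. \<phi> k x $ i)"
    and lim: "(\<lambda>k. L2_norm ?M (\<lambda>x. \<phi> k x - v x)) \<longlonglongrightarrow> 0"
      "(\<lambda>k. L2_norm ?M (grad \<Omega> (\<lambda>x. \<phi> k x - v x))) \<longlonglongrightarrow> 0"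
      "(\<lambda>k. L2_norm ?S (\<lambda>x. \<phi> k x - w x)) \<longlonglongrightarrow> 0"
    using assms(4) unfolding has_trace_def by auto
  obtain \<phi>' where v': "v' \<in> H1 \<Omega>" "w' \<in> L2_space ?S" and \<phi>': "\<And>k i. C_inf (\<lambda>x. \<phi>' k x $ i)"
    and lim': "(\<lambda>k. L2_norm ?M (\<lambda>x. \<phi>' k x - v' x)) \<longlonglongrightarrow> 0"
      "(\<lambda>k. L2_norm ?M (grad \<Omega> (\<lambda>x. \<phi>' k x - v' x))) \<longlonglongrightarrow> 0"
      "(\<lambda>k. L2_norm ?S (\<lambda>x. \<phi>' k x - w' x)) \<longlonglongrightarrow> 0"
    using assms(5) unfolding has_trace_def by auto
  note H1_diff' = H1_diff[OF assms(1,2)]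
  have H: "(\<lambda>x. \<phi> k x - v x) \<in> H1 \<Omega>" "(\<lambda>x. \<phi>' k x - v' x) \<in> H1 \<Omega>" for k
    using smooth_in_H1[OF assms(1,2) \<phi>] smooth_in_H1[OF assms(1,2) \<phi>'] v(1) v'(1) by (auto intro: H1_diff')
  have S: "(\<lambda>x. \<phi> k x - w x) \<in> L2_space ?S" "(\<lambda>x. \<phi>' k x - w' x) \<in> L2_space ?S" for k
    using continuous_L2_surface[OF assms(3,2) C_inf_vector_continuous[OF \<phi>]]
      continuous_L2_surface[OF assms(3,2) C_inf_vector_continuous[OF \<phi>']] v(2) v'(2)
    by (auto intro: L2_space_diff)
  define \<psi> where "\<psi> k x = \<phi> k x - \<phi>' k x" for k x
  have eq: "(\<lambda>x. \<psi> k x - (v x - v' x)) = (\<lambda>x. (\<phi> k x - v x) - (\<phi>' k x - v' x))"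
      "(\<lambda>x. \<psi> k x - (w x - w' x)) = (\<lambda>x. (\<phi> k x - w x) - (\<phi>' k x - w' x))" for k
    by (simp_all add: \<psi>_def fun_eq_iff)
  show ?thesis
    unfolding has_trace_def
  proof (intro conjI exI[of _ \<psi>] allI)
    show "(\<lambda>x. v x - v' x) \<in> H1 \<Omega>" by (rule H1_diff'[OF v(1) v'(1)])
    show "(\<lambda>x. w x - w' x) \<in> L2_space ?S" by (rule L2_space_diff[OF v(2) v'(2)])
    show "C_inf (\<lambda>x. \<psi> k x $ i)" for k i
      using C_inf_diff[OF \<phi> \<phi>'] by (simp add: \<psi>_def)
    show "(\<lambda>k. L2_norm ?M (\<lambda>x. \<psi> k x - (v x - v' x))) \<longlonglongrightarrow> 0"
      unfolding eq by (rule L2_norm_tendsto_0_diff[OF lim(1) lim'(1)]) (intro H1D(1) H)+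
    show "(\<lambda>k. L2_norm ?S (\<lambda>x. \<psi> k x - (w x - w' x))) \<longlonglongrightarrow> 0"
      unfolding eq by (rule L2_norm_tendsto_0_diff[OF lim(3) lim'(3)]) (rule S)+
    have "L2_norm ?M (grad \<Omega> (\<lambda>x. \<psi> k x - (v x - v' x)))
        = L2_norm ?M (\<lambda>x. grad \<Omega> (\<lambda>x. \<phi> k x - v x) x - grad \<Omega> (\<lambda>x. \<phi>' k x - v' x) x)" for k
      unfolding eq
      by (intro L2_norm_cong_AE grad_diff assms(1,2) H L2_spaceD(1) H1D(2) H1_diff' L2_space_diff)
    then show "(\<lambda>k. L2_norm ?M (grad \<Omega> (\<lambda>x. \<psi> k x - (v x - v' x)))) \<longlonglongrightarrow> 0"
      using L2_norm_tendsto_0_diff[OF lim(2) lim'(2) H1D(2)[OF H(1)] H1D(2)[OF H(2)]] by simp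
  qed
qed

lemma V_space_diff:
  assumes "open \<Omega>" "bounded \<Omega>" "finite_measure (surface_measure_on (frontier \<Omega>))"
    and "v \<in> V_space \<Omega> \<Gamma>" "w \<in> V_space \<Omega> \<Gamma>"
  shows "(\<lambda>x. v x - w x) \<in> V_space \<Omega> \<Gamma>"
proof -
  obtain v' where v: "v \<in> H1 \<Omega>" "has_trace \<Omega> v v'" "AE x in surface_measure_on \<Gamma>. 0 = v' x"
    using assms(4) by (auto simp: V_space_def has_trace_on_def)
  obtain w' where w: "w \<in> H1 \<Omega>" "has_trace \<Omega> w w'" "AE x in surface_measure_on \<Gamma>. 0 = w' x"
    using assms(5) by (auto simp: V_space_def has_trace_on_def)
  have "AE x in surface_measure_on \<Gamma>. 0 = v' x - w' x"
    using v(3) w(3) by eventually_elim simp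
  then show ?thesis
    using H1_diff[OF assms(1,2) v(1) w(1)] has_trace_diff[OF assms(1-3) v(2) w(2)]
    by (auto simp: V_space_def has_trace_on_def)
qed

section \<open>Material tensors\<close>

text \<open>A material tensor is linear only for almost every \<open>x\<close>, so its measurable coordinate expression
  agrees with it only almost everywhere; completeness of Lebesgue measure transfers measurability.\<close>

lemma (in complete_measure) measurable_AE_eq:
  assumes g: "g \<in> measurable M N" and ae: "AE x in M. f x = g x" and f: "f \<in> space M \<rightarrow> space N"
  shows "f \<in> measurable M N"
proof (rule measurableI)
  fix A assume A: "A \<in> sets N"
  define Z where "Z = {x \<in> space M. \<not> f x = g x}"
  have Z: "Z \<in> null_sets M" using ae unfolding Z_def by (simp add: AE_iff_null_sets)
  have "f -` A \<inter> space M = (g -` A \<inter> space M - Z) \<union> (f -` A \<inter> Z)"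
    by (auto simp: Z_def)
  moreover have "f -` A \<inter> Z \<in> sets M" using complete2[OF _ Z, of "f -` A \<inter> Z"] by auto
  ultimately show "f -` A \<inter> space M \<in> sets M"
    using measurable_sets[OF g A] Z by auto
qed (use f in auto)

lemma complete_measure_lebesgue_on:
  assumes "\<Omega> \<in> sets lebesgue"
  shows "complete_measure (lebesgue_on \<Omega>)"
proof
  fix A B assume "B \<subseteq> A" "A \<in> null_sets (lebesgue_on \<Omega>)"
  then have "A \<in> null_sets lebesgue" "B \<subseteq> \<Omega>"
    using assms by (auto simp: null_sets_restrict_space dest: null_setsD2)
  then show "B \<in> sets (lebesgue_on \<Omega>)"
    using \<open>B \<subseteq> A\<close> assms completion.complete2 by (metis null_setsD2 sets_restrict_space_iff sets.Int_space_eq2)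
qed

lemma borel_measurable_AE_eq_lebesgue_on:
  assumes "open \<Omega>" "g \<in> borel_measurable (lebesgue_on \<Omega>)" "AE x in lebesgue_on \<Omega>. f x = g x"
  shows "f \<in> borel_measurable (lebesgue_on \<Omega>)"
  using complete_measure.measurable_AE_eq[OF complete_measure_lebesgue_on assms(2,3)] assms(1) by auto

lemma L2_inner_diff_left:
  assumes "f \<in> L2_space M" "g \<in> L2_space M" "h \<in> L2_space M"
  shows "L2_inner M (\<lambda>x. f x - g x) h = L2_inner M f h - L2_inner M g h"
  using assms by (simp add: L2_inner_def inner_diff_left L2_integrable_inner)

lemma L2_inner_diff_right:
  assumes "f \<in> L2_space M" "g \<in> L2_space M" "h \<in> L2_space M"
  shows "L2_inner M h (\<lambda>x. f x - g x) = L2_inner M h f - L2_inner M h g"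
  using assms by (simp add: L2_inner_def inner_diff_right L2_integrable_inner)

lemma sym_matrices_add: "A \<in> sym_matrices \<Longrightarrow> B \<in> sym_matrices \<Longrightarrow> A + B \<in> sym_matrices"
  by (simp add: sym_matrices_def transpose_def vec_eq_iff)

lemma sym_matrices_diff: "A \<in> sym_matrices \<Longrightarrow> B \<in> sym_matrices \<Longrightarrow> A - B \<in> sym_matrices"
  by (simp add: sym_matrices_def transpose_def vec_eq_iff)

lemma sym_matrices_scaleR: "A \<in> sym_matrices \<Longrightarrow> c *\<^sub>R A \<in> sym_matrices"
  by (simp add: sym_matrices_def transpose_def vec_eq_iff)

lemma dev_sym_imp_sym: "A \<in> dev_sym_matrices \<Longrightarrow> A \<in> sym_matrices"
  by (simp add: sym_matrices_def dev_sym_matrices_def)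

lemma dev_sym_matrices_add:
  "A \<in> dev_sym_matrices \<Longrightarrow> B \<in> dev_sym_matrices \<Longrightarrow> A + B \<in> dev_sym_matrices"
  by (simp add: dev_sym_matrices_def transpose_def vec_eq_iff trace_add)

lemma dev_sym_matrices_scaleR: "A \<in> dev_sym_matrices \<Longrightarrow> c *\<^sub>R A \<in> dev_sym_matrices"
  by (simp add: dev_sym_matrices_def transpose_def vec_eq_iff trace_def sum_distrib_left[symmetric])

lemma Q_spaceD:
  assumes "q \<in> Q_space \<Omega>"
  shows "q \<in> L2_space (lebesgue_on \<Omega>)" "AE x in lebesgue_on \<Omega>. q x \<in> dev_sym_matrices"
  using assms by (auto simp: Q_space_def)

lemma Q_space_add:
  assumes "p \<in> Q_space \<Omega>" "q \<in> Q_space \<Omega>"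
  shows "(\<lambda>x. p x + q x) \<in> Q_space \<Omega>"
proof -
  have "AE x in lebesgue_on \<Omega>. p x + q x \<in> dev_sym_matrices"
    using Q_spaceD(2)[OF assms(1)] Q_spaceD(2)[OF assms(2)] by eventually_elim (rule dev_sym_matrices_add)
  then show ?thesis using L2_space_add[OF Q_spaceD(1) Q_spaceD(1), OF assms] by (simp add: Q_space_def)
qed

lemma Q_space_scaleR:
  assumes "p \<in> Q_space \<Omega>"
  shows "(\<lambda>x. c *\<^sub>R p x) \<in> Q_space \<Omega>"
proof -
  have "AE x in lebesgue_on \<Omega>. c *\<^sub>R p x \<in> dev_sym_matrices"
    using Q_spaceD(2)[OF assms] by eventually_elim (rule dev_sym_matrices_scaleR)
  then show ?thesis using L2_space_scaleR[OF Q_spaceD(1)[OF assms]] by (simp add: Q_space_def)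
qed

lemma Q_space_diff:
  "p \<in> Q_space \<Omega> \<Longrightarrow> q \<in> Q_space \<Omega> \<Longrightarrow> (\<lambda>x. p x - q x) \<in> Q_space \<Omega>"
  using Q_space_add[OF _ Q_space_scaleR[of q \<Omega> "-1"], of p] by simp

text \<open>Strains minus plastic strains live here: they are symmetric but in general not trace free, so
  they need not belong to \<^const>\<open>Q_space\<close>.\<close>

definition L2_sym :: "(real^'n::finite) set \<Rightarrow> (real^'n \<Rightarrow> real^'n^'n) set" where
  "L2_sym \<Omega> = {s \<in> L2_space (lebesgue_on \<Omega>). AE x in lebesgue_on \<Omega>. s x \<in> sym_matrices}"

lemma Q_space_subset_L2_sym: "q \<in> Q_space \<Omega> \<Longrightarrow> q \<in> L2_sym \<Omega>"
  by (auto simp: Q_space_def L2_sym_def elim!: eventually_mono intro: dev_sym_imp_sym)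

lemma L2_sym_diff:
  assumes "s \<in> L2_sym \<Omega>" "t \<in> L2_sym \<Omega>"
  shows "(\<lambda>x. s x - t x) \<in> L2_sym \<Omega>"
proof -
  have "AE x in lebesgue_on \<Omega>. s x \<in> sym_matrices" "AE x in lebesgue_on \<Omega>. t x \<in> sym_matrices"
    using assms by (auto simp: L2_sym_def)
  then have "AE x in lebesgue_on \<Omega>. s x - t x \<in> sym_matrices"
    by eventually_elim (rule sym_matrices_diff)
  then show ?thesis using assms by (simp add: L2_sym_def L2_space_diff)
qed

definition sym_part :: "real^'n^'n \<Rightarrow> real^'n^'n" where
  "sym_part A = (1/2) *\<^sub>R (A + transpose A)"

lemma sym_part_linear: "linear sym_part"
  by (simp add: linear_iff sym_part_def transpose_def vec_eq_iff algebra_simps)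

lemma sym_part_sym: "sym_part A \<in> sym_matrices"
  by (simp add: sym_part_def sym_matrices_def transpose_def vec_eq_iff)

lemma sym_part_eq: "A \<in> sym_matrices \<Longrightarrow> sym_part A = A"
  by (simp add: sym_part_def sym_matrices_def flip: scaleR_2)

text \<open>The matrices of the standard basis are in general not symmetric, so the tensor cannot be evaluated at
  them; their symmetric parts still span the symmetric matrices, with the same coefficients.\<close>

lemma sym_matrix_expansion:
  assumes "A \<in> sym_matrices"
  shows "A = (\<Sum>b\<in>Basis. (A \<bullet> b) *\<^sub>R sym_part b)"
proof -
  have "A = sym_part (\<Sum>b\<in>Basis. (A \<bullet> b) *\<^sub>R b)"
    using sym_part_eq[OF assms] by (simp add: euclidean_representation)
  also have "\<dots> = (\<Sum>b\<in>Basis. (A \<bullet> b) *\<^sub>R sym_part b)"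
    by (simp add: linear_sum[OF sym_part_linear] linear_cmul[OF sym_part_linear])
  finally show ?thesis .
qed

lemma material_tensorD:
  assumes "material_tensor \<Omega> T"
  shows "A \<in> sym_matrices \<Longrightarrow> (\<lambda>x. T x A) \<in> borel_measurable (lebesgue_on \<Omega>)"
    and "AE x in lebesgue_on \<Omega>. \<forall>A\<in>sym_matrices. \<forall>B\<in>sym_matrices. T x (A + B) = T x A + T x B"
    and "AE x in lebesgue_on \<Omega>. \<forall>A\<in>sym_matrices. \<forall>r. T x (r *\<^sub>R A) = r *\<^sub>R T x A"
    and "\<exists>K. AE x in lebesgue_on \<Omega>. \<forall>A\<in>sym_matrices. norm (T x A) \<le> K * norm A"
proof -
  show "A \<in> sym_matrices \<Longrightarrow> (\<lambda>x. T x A) \<in> borel_measurable (lebesgue_on \<Omega>)"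
    "\<exists>K. AE x in lebesgue_on \<Omega>. \<forall>A\<in>sym_matrices. norm (T x A) \<le> K * norm A"
    using assms unfolding material_tensor_def by blast+
  have "AE x in lebesgue_on \<Omega>.
        (\<forall>A\<in>sym_matrices. T x A \<in> sym_matrices) \<and>
        (\<forall>A\<in>sym_matrices. \<forall>B\<in>sym_matrices. T x (A + B) = T x A + T x B) \<and>
        (\<forall>A\<in>sym_matrices. \<forall>r. T x (r *\<^sub>R A) = r *\<^sub>R T x A) \<and>
        (\<forall>A\<in>sym_matrices. \<forall>B\<in>sym_matrices. T x A \<bullet> B = A \<bullet> T x B)"
    using assms unfolding material_tensor_def by blast
  then show "AE x in lebesgue_on \<Omega>. \<forall>A\<in>sym_matrices. \<forall>B\<in>sym_matrices. T x (A + B) = T x A + T x B"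
    "AE x in lebesgue_on \<Omega>. \<forall>A\<in>sym_matrices. \<forall>r. T x (r *\<^sub>R A) = r *\<^sub>R T x A"
    by (eventually_elim, blast)+
qed

lemma linear_on_sym_sum:
  assumes add: "\<And>A B. A \<in> sym_matrices \<Longrightarrow> B \<in> sym_matrices \<Longrightarrow> L (A + B) = L A + L B"
    and scale: "\<And>A r. A \<in> sym_matrices \<Longrightarrow> L (r *\<^sub>R A) = r *\<^sub>R (L A :: 'b::real_vector)"
    and "finite I" "\<And>i. i \<in> I \<Longrightarrow> E i \<in> sym_matrices"
  shows "L (\<Sum>i\<in>I. c i *\<^sub>R E i) = (\<Sum>i\<in>I. c i *\<^sub>R L (E i)) \<and> (\<Sum>i\<in>I. c i *\<^sub>R E i) \<in> sym_matrices"
  using assms(3,4)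
proof (induction I rule: finite_induct)
  case empty
  have 0: "0 \<in> sym_matrices" by (simp add: sym_matrices_def transpose_def vec_eq_iff)
  then show ?case using scale[OF 0, of 0] by simp
next
  case (insert i I)
  then have "c i *\<^sub>R E i \<in> sym_matrices" by (auto intro: sym_matrices_scaleR)
  then show ?case using insert add scale by (auto intro: sym_matrices_add)
qed

text \<open>Measurability of \<open>T x A\<close> is given for fixed \<open>A\<close> only; for the moving argument \<open>s x\<close> it follows by
  linearity from the finite expansion of \<open>s x\<close>.\<close>

lemma material_tensor_L2:
  assumes "open \<Omega>" and T: "material_tensor \<Omega> T" and s: "s \<in> L2_sym \<Omega>"
  shows "(\<lambda>x. T x (s x)) \<in> L2_space (lebesgue_on \<Omega>)"
proof -
  have s2: "s \<in> L2_space (lebesgue_on \<Omega>)" "AE x in lebesgue_on \<Omega>. s x \<in> sym_matrices"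
    using s by (auto simp: L2_sym_def)
  have [measurable]: "s \<in> borel_measurable (lebesgue_on \<Omega>)"
    using s2(1) by (rule L2_spaceD)
  have "(\<lambda>x. \<Sum>b\<in>Basis. (s x \<bullet> b) *\<^sub>R T x (sym_part b)) \<in> borel_measurable (lebesgue_on \<Omega>)"
    by (intro borel_measurable_sum borel_measurable_scaleR borel_measurable_inner
        material_tensorD(1)[OF T sym_part_sym]) auto
  moreover have "AE x in lebesgue_on \<Omega>. T x (s x) = (\<Sum>b\<in>Basis. (s x \<bullet> b) *\<^sub>R T x (sym_part b))"
    using material_tensorD(2,3)[OF T] s2(2)
  proof eventually_elim
    case (elim x)
    have "T x (\<Sum>b\<in>Basis. (s x \<bullet> b) *\<^sub>R sym_part b) = (\<Sum>b\<in>Basis. (s x \<bullet> b) *\<^sub>R T x (sym_part b))"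
      by (rule linear_on_sym_sum[THEN conjunct1]) (use elim sym_part_sym in auto)
    then show ?case using sym_matrix_expansion[OF elim(3)] by simp
  qed
  ultimately have meas: "(\<lambda>x. T x (s x)) \<in> borel_measurable (lebesgue_on \<Omega>)"
    by (rule borel_measurable_AE_eq_lebesgue_on[OF assms(1)])
  obtain K where K: "AE x in lebesgue_on \<Omega>. \<forall>A\<in>sym_matrices. norm (T x A) \<le> K * norm A"
    using material_tensorD(4)[OF T] by blast
  show ?thesis
  proof (rule L2_space_bound[OF _ meas])
    show "integrable (lebesgue_on \<Omega>) (\<lambda>x. K\<^sup>2 * (norm (s x))\<^sup>2)"
      using L2_spaceD(2)[OF s2(1)] by simp
    show "AE x in lebesgue_on \<Omega>. (norm (T x (s x)))\<^sup>2 \<le> K\<^sup>2 * (norm (s x))\<^sup>2"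
      using K s2(2)
    proof eventually_elim
      case (elim x)
      then have "(norm (T x (s x)))\<^sup>2 \<le> (K * norm (s x))\<^sup>2"
        by (intro power_mono) auto
      then show ?case by (simp add: power_mult_distrib)
    qed
  qed
qed

text \<open>The bilinear expansion of \<open>b (s - t) (s - t)\<close>. The separate \<open>r\<close> is there because the symmetric
  gradient of a difference equals the difference of the symmetric gradients only almost everywhere.\<close>

lemma material_tensor_quadratic_diff:
  assumes "open \<Omega>" and T: "material_tensor \<Omega> T"
    and s: "s \<in> L2_sym \<Omega>" and t: "t \<in> L2_sym \<Omega>" and r: "r \<in> L2_sym \<Omega>"
    and eq: "AE x in lebesgue_on \<Omega>. r x = s x - t x"
  defines "b \<equiv> \<lambda>s t. L2_inner (lebesgue_on \<Omega>) (\<lambda>x. T x (s x)) t"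
  shows "b r r = b s s - b s t - b t s + b t t"
proof -
  let ?M = "lebesgue_on \<Omega>"
  have L2: "s \<in> L2_space ?M" "t \<in> L2_space ?M" "r \<in> L2_space ?M"
    using s t r by (auto simp: L2_sym_def)
  note T2 = material_tensor_L2[OF assms(1) T]
  have sym: "AE x in ?M. s x \<in> sym_matrices" "AE x in ?M. t x \<in> sym_matrices"
    using s t by (auto simp: L2_sym_def)
  have "b r r = (\<integral>x. (T x (s x) - T x (t x)) \<bullet> (s x - t x) \<partial>?M)"
    unfolding b_def L2_inner_def
  proof (rule integral_cong_AE)
    show "(\<lambda>x. T x (r x) \<bullet> r x) \<in> borel_measurable ?M"
      using L2_spaceD(1)[OF T2[OF r]] L2_spaceD(1)[OF L2(3)] by measurable
    show "(\<lambda>x. (T x (s x) - T x (t x)) \<bullet> (s x - t x)) \<in> borel_measurable ?M"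
      using L2_spaceD(1)[OF T2[OF s]] L2_spaceD(1)[OF T2[OF t]] L2_spaceD(1)[OF L2(1)] L2_spaceD(1)[OF L2(2)]
      by measurable
    show "AE x in ?M. T x (r x) \<bullet> r x = (T x (s x) - T x (t x)) \<bullet> (s x - t x)"
      using material_tensorD(2,3)[OF T] sym eq
    proof eventually_elim
      case (elim x)
      have "T x (s x + (-1) *\<^sub>R t x) = T x (s x) + T x ((-1) *\<^sub>R t x)"
        using elim sym_matrices_scaleR by blast
      also have "T x ((-1) *\<^sub>R t x) = (-1) *\<^sub>R T x (t x)" using elim by blast
      finally show ?case using elim(5) by simp
    qed
  qed
  also have "\<dots> = L2_inner ?M (\<lambda>x. T x (s x) - T x (t x)) (\<lambda>x. s x - t x)"
    by (simp add: L2_inner_def)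
  also have "\<dots> = b s s - b s t - b t s + b t t"
    unfolding b_def
    by (simp add: L2_inner_diff_left L2_inner_diff_right T2 s t L2 L2_space_diff)
  finally show ?thesis .
qed

section \<open>Strains and the norm on V x Q\<close>

lemma sym_grad_eq_sym_part: "sym_grad \<Omega> v x = sym_part (grad \<Omega> v x)"
  by (simp add: sym_grad_def sym_part_def)

lemma sym_grad_L2_sym:
  fixes v :: "real^'n \<Rightarrow> real^'n"
  assumes "v \<in> H1 \<Omega>"
  shows "sym_grad \<Omega> v \<in> L2_sym \<Omega>"
proof -
  have "bounded_linear (sym_part :: real^'n^'n \<Rightarrow> _)"
    using sym_part_linear by (simp add: linear_conv_bounded_linear)
  from L2_space_bounded_linear[OF H1D(2)[OF assms] this] show ?thesis
    by (simp add: L2_sym_def sym_grad_eq_sym_part[abs_def] sym_part_sym)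
qed

lemma sym_grad_diff:
  assumes "open \<Omega>" "bounded \<Omega>" "v \<in> H1 \<Omega>" "w \<in> H1 \<Omega>"
  shows "AE x in lebesgue_on \<Omega>. sym_grad \<Omega> (\<lambda>x. v x - w x) x = sym_grad \<Omega> v x - sym_grad \<Omega> w x"
  using grad_diff[OF assms]
  by eventually_elim (simp add: sym_grad_eq_sym_part linear_diff[OF sym_part_linear])

lemma V_space_H1: "v \<in> V_space \<Omega> \<Gamma> \<Longrightarrow> v \<in> H1 \<Omega>"
  by (simp add: V_space_def)

lemma VQ_norm_squared:
  "(VQ_norm \<Omega> v q)\<^sup>2 = (L2_norm (lebesgue_on \<Omega>) v)\<^sup>2
     + (L2_norm (lebesgue_on \<Omega>) (sym_grad \<Omega> v))\<^sup>2 + (L2_norm (lebesgue_on \<Omega>) q)\<^sup>2"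
  by (simp add: VQ_norm_def norm1_def)

lemma VQ_norm_nonneg: "0 \<le> VQ_norm \<Omega> v q"
  by (simp add: VQ_norm_def)

lemma L2_norm_le_VQ_norm: "L2_norm (lebesgue_on \<Omega>) q \<le> VQ_norm \<Omega> v q"
  by (rule power2_le_imp_le) (simp_all add: VQ_norm_squared VQ_norm_nonneg)

lemma VQ_norm_triangle_squared:
  assumes "open \<Omega>" "bounded \<Omega>" "u \<in> H1 \<Omega>" "v \<in> H1 \<Omega>" "w \<in> H1 \<Omega>"
    and "p \<in> Q_space \<Omega>" "q \<in> Q_space \<Omega>" "r \<in> Q_space \<Omega>"
  shows "(VQ_norm \<Omega> (\<lambda>x. u x - w x) (\<lambda>x. p x - r x))\<^sup>2
    \<le> 2 * (VQ_norm \<Omega> (\<lambda>x. u x - v x) (\<lambda>x. p x - q x))\<^sup>2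
      + 2 * (VQ_norm \<Omega> (\<lambda>x. v x - w x) (\<lambda>x. q x - r x))\<^sup>2"
proof -
  let ?M = "lebesgue_on \<Omega>"
  note D = H1_diff[OF assms(1,2)] and G = sym_grad_diff[OF assms(1,2)]
  have SG: "sym_grad \<Omega> y \<in> L2_space ?M" if "y \<in> H1 \<Omega>" for y
    using sym_grad_L2_sym[OF that] by (simp add: L2_sym_def)
  have "(L2_norm ?M (\<lambda>x. u x - w x))\<^sup>2
      \<le> 2 * (L2_norm ?M (\<lambda>x. u x - v x))\<^sup>2 + 2 * (L2_norm ?M (\<lambda>x. v x - w x))\<^sup>2"
    using L2_norm_add_squared_le[OF H1D(1)[OF D[OF assms(3,4)]] H1D(1)[OF D[OF assms(4,5)]]] by simp
  moreover have "(L2_norm ?M (\<lambda>x. p x - r x))\<^sup>2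
      \<le> 2 * (L2_norm ?M (\<lambda>x. p x - q x))\<^sup>2 + 2 * (L2_norm ?M (\<lambda>x. q x - r x))\<^sup>2"
    using L2_norm_add_squared_le[OF Q_spaceD(1)[OF Q_space_diff[OF assms(6,7)]]
        Q_spaceD(1)[OF Q_space_diff[OF assms(7,8)]]] by simp
  moreover have "(L2_norm ?M (sym_grad \<Omega> (\<lambda>x. u x - w x)))\<^sup>2
      \<le> 2 * (L2_norm ?M (sym_grad \<Omega> (\<lambda>x. u x - v x)))\<^sup>2 + 2 * (L2_norm ?M (sym_grad \<Omega> (\<lambda>x. v x - w x)))\<^sup>2"
  proof -
    note S = SG[OF D[OF assms(3,4)]] SG[OF D[OF assms(4,5)]]
    have "AE x in ?M. sym_grad \<Omega> (\<lambda>x. u x - w x) x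
        = sym_grad \<Omega> (\<lambda>x. u x - v x) x + sym_grad \<Omega> (\<lambda>x. v x - w x) x"
      using G[OF assms(3,5)] G[OF assms(3,4)] G[OF assms(4,5)] by eventually_elim simp
    then have "L2_norm ?M (sym_grad \<Omega> (\<lambda>x. u x - w x))
        = L2_norm ?M (\<lambda>x. sym_grad \<Omega> (\<lambda>x. u x - v x) x + sym_grad \<Omega> (\<lambda>x. v x - w x) x)"
      by (rule L2_norm_cong_AE) (intro L2_spaceD(1) L2_space_add S SG[OF D[OF assms(3,5)]])+
    then show ?thesis using L2_norm_add_squared_le[OF S] by simp
  qed
  ultimately show ?thesis by (simp add: VQ_norm_squared)
qed

lemma a_form_quadratic_diff:
  assumes "open \<Omega>" "bounded \<Omega>" and C: "material_tensor \<Omega> C" and H: "material_tensor \<Omega> H"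
    and u: "u \<in> H1 \<Omega>" and v: "v \<in> H1 \<Omega>" and p: "p \<in> Q_space \<Omega>" and q: "q \<in> Q_space \<Omega>"
  shows "a_form \<Omega> C H (\<lambda>x. u x - v x) (\<lambda>x. p x - q x) (\<lambda>x. u x - v x) (\<lambda>x. p x - q x)
    = a_form \<Omega> C H u p u p - a_form \<Omega> C H u p v q - a_form \<Omega> C H v q u p + a_form \<Omega> C H v q v q"
proof -
  note pq = Q_space_subset_L2_sym[OF p] Q_space_subset_L2_sym[OF q]
    Q_space_subset_L2_sym[OF Q_space_diff[OF p q]]
  have AE: "AE x in lebesgue_on \<Omega>. sym_grad \<Omega> (\<lambda>x. u x - v x) x - (p x - q x)
      = (sym_grad \<Omega> u x - p x) - (sym_grad \<Omega> v x - q x)"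
    using sym_grad_diff[OF assms(1,2) u v] by eventually_elim simp
  note 1 = material_tensor_quadratic_diff[OF assms(1) C
      L2_sym_diff[OF sym_grad_L2_sym[OF u] pq(1)] L2_sym_diff[OF sym_grad_L2_sym[OF v] pq(2)]
      L2_sym_diff[OF sym_grad_L2_sym[OF H1_diff[OF assms(1,2) u v]] pq(3)] AE]
  note 2 = material_tensor_quadratic_diff[OF assms(1) H pq AE_I2[OF refl]]
  show ?thesis
    unfolding a_form_def stress_def[abs_def] 1 2 by simp
qed

section \<open>The projected multiplier\<close>

lemma radial_projection_norm_le:
  assumes "\<sigma> > 0" shows "norm (min 1 (\<sigma> / norm m) *\<^sub>R m) \<le> \<sigma>"
proof (cases "norm m \<le> \<sigma>")
  case True
  have "norm (min 1 (\<sigma> / norm m) *\<^sub>R m) \<le> 1 * norm m"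
    unfolding norm_scaleR using assms by (intro mult_right_mono) (auto simp: min_def)
  then show ?thesis using True by simp
next
  case False
  then have "\<sigma> / norm m < 1" "0 < norm m" using assms by (auto simp: divide_less_eq)
  then show ?thesis using assms by (auto simp: min_def)
qed

lemma radial_projection_nearest:
  assumes "\<sigma> > 0" "norm \<nu> \<le> \<sigma>"
  shows "norm (min 1 (\<sigma> / norm m) *\<^sub>R m - m) \<le> norm (\<nu> - m)"
proof (cases "norm m \<le> \<sigma>")
  case True
  then have "min 1 (\<sigma> / norm m) *\<^sub>R m = m" using assms(1)
    by (cases "m = 0") (auto simp: min_def divide_less_eq field_simps)
  then show ?thesis by simp
next
  case False
  then have m: "\<sigma> / norm m < 1" "0 < norm m" using assms by (auto simp: divide_less_eq)
  then have "min 1 (\<sigma> / norm m) *\<^sub>R m - m = (\<sigma> / norm m - 1) *\<^sub>R m"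
    by (simp add: min_def scaleR_diff_left)
  then have "norm (min 1 (\<sigma> / norm m) *\<^sub>R m - m) = (1 - \<sigma> / norm m) * norm m"
    using m(1) by simp
  also have "\<dots> = norm m - \<sigma>" using m(2) by (simp add: left_diff_distrib)
  also have "\<dots> \<le> norm (\<nu> - m)"
    using assms(2) norm_triangle_ineq2[of m \<nu>] by (simp add: norm_minus_commute)
  finally show ?thesis .
qed

text \<open>Completing the square: up to a term independent of \<open>\<mu>\<close>, the functional is the squared distance
  to \<open>m\<close>, and radial projection is the nearest-point map onto the ball of radius \<open>\<sigma>\<close>.\<close>

lemma radial_projection_minimises:
  fixes l p \<nu> :: "'a::real_inner"
  assumes "\<sigma> > 0" "norm \<nu> \<le> \<sigma>"
  defines "m \<equiv> l + (1/2) *\<^sub>R p"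
  defines "\<mu> \<equiv> min 1 (\<sigma> / norm m) *\<^sub>R m"
  shows "(norm (\<mu> - l))\<^sup>2 - \<mu> \<bullet> p \<le> (norm (\<nu> - l))\<^sup>2 - \<nu> \<bullet> p"
proof -
  have square: "(norm (y - l))\<^sup>2 - y \<bullet> p = (norm (y - m))\<^sup>2 + (l \<bullet> l - m \<bullet> m)" for y
    unfolding power2_norm_eq_inner m_def by (simp add: inner_simps inner_commute algebra_simps)
  have "(norm (\<mu> - m))\<^sup>2 \<le> (norm (\<nu> - m))\<^sup>2"
    unfolding \<mu>_def by (intro power_mono radial_projection_nearest assms(1,2)) simp
  then show ?thesis unfolding square by simp
qed

lemma mu_star_in_Lambda:
  assumes "open \<Omega>" "bounded \<Omega>" "\<sigma> > 0" "p \<in> Q_space \<Omega>" "l \<in> Q_space \<Omega>"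
  shows "mu_star \<sigma> p l \<in> Lambda_set \<Omega> \<sigma>"
proof -
  have m: "(\<lambda>x. l x + (1/2) *\<^sub>R p x) \<in> Q_space \<Omega>"
    using Q_space_add[OF assms(5) Q_space_scaleR[OF assms(4)]] .
  have bound: "norm (mu_star \<sigma> p l x) \<le> \<sigma>" for x
    unfolding mu_star_def Let_def by (rule radial_projection_norm_le[OF assms(3)])
  have "mu_star \<sigma> p l \<in> borel_measurable (lebesgue_on \<Omega>)"
    using L2_spaceD(1)[OF Q_spaceD(1)[OF m]] unfolding mu_star_def[abs_def] Let_def by measurable
  then have "mu_star \<sigma> p l \<in> L2_space (lebesgue_on \<Omega>)"
    using bound by (intro L2_space_bounded[OF finite_measure_lebesgue_on_open[OF assms(1,2)]]) auto
  moreover have "AE x in lebesgue_on \<Omega>. mu_star \<sigma> p l x \<in> dev_sym_matrices"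
    using Q_spaceD(2)[OF m] unfolding mu_star_def Let_def by eventually_elim (rule dev_sym_matrices_scaleR)
  ultimately show ?thesis using bound by (simp add: Lambda_set_def Q_space_def)
qed

lemma Lambda_setD:
  assumes "\<mu> \<in> Lambda_set \<Omega> \<sigma>"
  shows "\<mu> \<in> Q_space \<Omega>" "AE x in lebesgue_on \<Omega>. norm (\<mu> x) \<le> \<sigma>"
  using assms by (auto simp: Lambda_set_def)

lemma norm_Q_integrable:
  assumes "open \<Omega>" "bounded \<Omega>" "q \<in> Q_space \<Omega>"
  shows "integrable (lebesgue_on \<Omega>) (\<lambda>x. norm (q x))"
  using assms by (intro integrable_norm L2_integrable finite_measure_lebesgue_on_open Q_spaceD(1))

text \<open>The dissipation of \<open>p\<close> does not involve the multiplier, so minimising \<open>E\<close> is the pointwise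
  problem solved by radial projection.\<close>

lemma error_E_mu_star_le:
  assumes "open \<Omega>" "bounded \<Omega>" "\<sigma> > 0" "p \<in> Q_space \<Omega>" "l \<in> Q_space \<Omega>" "\<nu> \<in> Lambda_set \<Omega> \<sigma>"
  shows "error_E \<Omega> \<sigma> p l (mu_star \<sigma> p l) \<le> error_E \<Omega> \<sigma> p l \<nu>"
proof -
  let ?M = "lebesgue_on \<Omega>" and ?\<mu> = "mu_star \<sigma> p l"
  have Q: "?\<mu> \<in> Q_space \<Omega>" "\<nu> \<in> Q_space \<Omega>"
    using Lambda_setD(1) mu_star_in_Lambda[OF assms(1-5)] assms(6) by auto
  have int: "integrable ?M (\<lambda>x. (norm (y x - l x))\<^sup>2)" "integrable ?M (\<lambda>x. y x \<bullet> p x)" if "y \<in> Q_space \<Omega>" for y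
    using L2_spaceD(2)[OF Q_spaceD(1)[OF Q_space_diff[OF that assms(5)]]]
      L2_integrable_inner[OF Q_spaceD(1) Q_spaceD(1), OF that assms(4)] by auto
  have split: "(L2_norm ?M (\<lambda>x. y x - l x))\<^sup>2 - L2_inner ?M y p
      = (\<integral>x. (norm (y x - l x))\<^sup>2 - y x \<bullet> p x \<partial>?M)" if "y \<in> Q_space \<Omega>" for y
    using int[OF that] by (simp add: L2_norm_squared L2_inner_def)
  have "(\<integral>x. (norm (?\<mu> x - l x))\<^sup>2 - ?\<mu> x \<bullet> p x \<partial>?M) \<le> (\<integral>x. (norm (\<nu> x - l x))\<^sup>2 - \<nu> x \<bullet> p x \<partial>?M)"
  proof (rule integral_mono_AE)
    show "AE x in ?M. (norm (?\<mu> x - l x))\<^sup>2 - ?\<mu> x \<bullet> p x \<le> (norm (\<nu> x - l x))\<^sup>2 - \<nu> x \<bullet> p x"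
      using Lambda_setD(2)[OF assms(6)]
      by eventually_elim
        (use radial_projection_minimises[OF assms(3)] in \<open>simp add: mu_star_def Let_def\<close>)
  qed (use int[OF Q(1)] int[OF Q(2)] in auto)
  then show ?thesis
    using split[OF Q(1)] split[OF Q(2)] by (simp add: error_E_def)
qed

text \<open>Test the variational inequality with the multiplier of norm \<open>\<sigma>\<close> in the direction of \<open>p\<close>, which
  attains the dissipation.\<close>

lemma plastic_dissipation_le_inner:
  assumes "open \<Omega>" "bounded \<Omega>" "\<sigma> > 0" "p \<in> Q_space \<Omega>" "l \<in> Q_space \<Omega>"
    and var: "\<And>\<mu>. \<mu> \<in> Lambda_set \<Omega> \<sigma> \<Longrightarrow> L2_inner (lebesgue_on \<Omega>) (\<lambda>x. \<mu> x - l x) p \<le> 0"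
  shows "plastic_dissipation \<Omega> \<sigma> p \<le> L2_inner (lebesgue_on \<Omega>) l p"
proof -
  let ?M = "lebesgue_on \<Omega>"
  \<comment> \<open>Where \<open>p\<close> vanishes this is \<open>0\<close>, since division by zero gives \<open>0\<close>.\<close>
  define \<mu> where "\<mu> x = (\<sigma> / norm (p x)) *\<^sub>R p x" for x
  have bound: "norm (\<mu> x) \<le> \<sigma>" for x using assms(3) by (simp add: \<mu>_def)
  have "\<mu> \<in> borel_measurable ?M"
    using L2_spaceD(1)[OF Q_spaceD(1)[OF assms(4)]] unfolding \<mu>_def by measurable
  then have "\<mu> \<in> L2_space ?M"
    using bound by (intro L2_space_bounded[OF finite_measure_lebesgue_on_open[OF assms(1,2)]]) auto
  moreover have "AE x in ?M. \<mu> x \<in> dev_sym_matrices"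
    using Q_spaceD(2)[OF assms(4)] unfolding \<mu>_def by eventually_elim (rule dev_sym_matrices_scaleR)
  ultimately have \<mu>: "\<mu> \<in> Lambda_set \<Omega> \<sigma>" using bound by (simp add: Lambda_set_def Q_space_def)
  have "\<mu> x \<bullet> p x = \<sigma> \<bullet> norm (p x)" for x
    by (cases "p x = 0") (simp_all add: \<mu>_def power2_norm_eq_inner[symmetric] power2_eq_square)
  then have "plastic_dissipation \<Omega> \<sigma> p = L2_inner ?M \<mu> p"
    by (simp add: plastic_dissipation_def L2_inner_def)
  then show ?thesis
    using var[OF \<mu>] L2_inner_diff_left[OF Q_spaceD(1)[OF Lambda_setD(1)[OF \<mu>]] Q_spaceD(1)[OF assms(5)] Q_spaceD(1)[OF assms(4)]]
    by simp
qed

text \<open>For \<open>r = p\<close> the left-hand side is nonpositive by the variational inequality. As a function of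
  \<open>r\<close> it is Lipschitz with constant \<open>2 \<sigma>\<close> in the \<open>L\<^sup>1\<close> norm, and Cauchy-Schwarz against the
  constant \<open>1\<close> passes to the \<open>L\<^sup>2\<close> norm.\<close>

lemma dissipation_gap_le:
  assumes "open \<Omega>" "bounded \<Omega>" "\<sigma> > 0" "p \<in> Q_space \<Omega>" "r \<in> Q_space \<Omega>" "l \<in> Lambda_set \<Omega> \<sigma>"
    and var: "\<And>\<mu>. \<mu> \<in> Lambda_set \<Omega> \<sigma> \<Longrightarrow> L2_inner (lebesgue_on \<Omega>) (\<lambda>x. \<mu> x - l x) p \<le> 0"
  shows "plastic_dissipation \<Omega> \<sigma> r - L2_inner (lebesgue_on \<Omega>) l r
    \<le> 2 * \<sigma> * L2_norm (lebesgue_on \<Omega>) (\<lambda>_. 1::real) * L2_norm (lebesgue_on \<Omega>) (\<lambda>x. p x - r x)"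
proof -
  let ?M = "lebesgue_on \<Omega>"
  note l = Lambda_setD[OF assms(6)]
  note int = norm_Q_integrable[OF assms(1,2)]
  have int_l: "integrable ?M (\<lambda>x. l x \<bullet> y x)" if "y \<in> Q_space \<Omega>" for y
    using L2_integrable_inner[OF Q_spaceD(1) Q_spaceD(1), OF l(1) that] .
  have pr: "(\<lambda>x. p x - r x) \<in> Q_space \<Omega>" using assms(4,5) by (rule Q_space_diff)
  have "plastic_dissipation \<Omega> \<sigma> r - L2_inner ?M l r
      \<le> (plastic_dissipation \<Omega> \<sigma> r - L2_inner ?M l r) - (plastic_dissipation \<Omega> \<sigma> p - L2_inner ?M l p)"
    using plastic_dissipation_le_inner[OF assms(1-4) l(1) var] by simp
  also have "\<dots> = (\<integral>x. \<sigma> * norm (r x) - l x \<bullet> r x - (\<sigma> * norm (p x) - l x \<bullet> p x) \<partial>?M)"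
    using int[OF assms(4)] int[OF assms(5)] int_l[OF assms(4)] int_l[OF assms(5)]
    by (simp add: plastic_dissipation_def L2_inner_def)
  also have "\<dots> \<le> (\<integral>x. 2 * \<sigma> * (1 * norm (p x - r x)) \<partial>?M)"
  proof (rule integral_mono_AE)
    show "AE x in ?M. \<sigma> * norm (r x) - l x \<bullet> r x - (\<sigma> * norm (p x) - l x \<bullet> p x) \<le> 2 * \<sigma> * (1 * norm (p x - r x))"
      using l(2)
    proof eventually_elim
      case (elim x)
      have "\<sigma> * norm (r x) - \<sigma> * norm (p x) \<le> \<sigma> * norm (p x - r x)"
        using mult_left_mono[OF norm_triangle_ineq2[of "r x" "p x"], of \<sigma>] assms(3)
        by (simp add: norm_minus_commute right_diff_distrib)
      moreover have "l x \<bullet> p x - l x \<bullet> r x \<le> \<sigma> * norm (p x - r x)"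
        using norm_cauchy_schwarz[of "l x" "p x - r x"] mult_right_mono[OF elim, of "norm (p x - r x)"]
        by (simp add: inner_diff_right)
      ultimately show ?case by simp
    qed
  qed (use int[OF assms(4)] int[OF assms(5)] int_l[OF assms(4)] int_l[OF assms(5)] int[OF pr] in auto)
  also have "\<dots> = 2 * \<sigma> * L2_inner ?M (\<lambda>_. 1) (\<lambda>x. norm (p x - r x))"
    by (simp add: L2_inner_def)
  also have "\<dots> \<le> 2 * \<sigma> * (L2_norm ?M (\<lambda>_. 1::real) * L2_norm ?M (\<lambda>x. p x - r x))"
  proof (rule mult_left_mono)
    have "(\<lambda>_. 1::real) \<in> L2_space ?M"
      by (rule L2_space_bounded[OF finite_measure_lebesgue_on_open[OF assms(1,2)], where B=1]) auto
    moreover have "(\<lambda>x. norm (p x - r x)) \<in> L2_space ?M"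
      using L2_spaceD[OF Q_spaceD(1)[OF pr]] by (simp add: L2_space_def)
    ultimately have "L2_inner ?M (\<lambda>_. 1) (\<lambda>x. norm (p x - r x))
        \<le> L2_norm ?M (\<lambda>_. 1::real) * L2_norm ?M (\<lambda>x. norm (p x - r x))"
      by (intro abs_le_D1[OF L2_Cauchy_Schwarz])
    then show "L2_inner ?M (\<lambda>_. 1) (\<lambda>x. norm (p x - r x)) \<le> L2_norm ?M (\<lambda>_. 1::real) * L2_norm ?M (\<lambda>x. p x - r x)"
      by (simp add: L2_norm_def)
  qed (use assms(3) in simp)
  finally show ?thesis by (simp add: mult.assoc)
qed

section \<open>The error estimate\<close>

text \<open>Expanding \<open>a(e, e)\<close> into four terms and inserting the two equations makes the loads cancel in
  pairs; what is left is \<open>(l - l', p' - p)\<close>, to which Cauchy-Schwarz applies.\<close>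

lemma auxiliary_error_le:
  assumes "open \<Omega>" "bounded \<Omega>" "finite_measure (surface_measure_on (frontier \<Omega>))"
    and "material_tensor \<Omega> C" "material_tensor \<Omega> H"
    and "\<alpha> > 0"
    and ell: "\<And>v q. v \<in> V_space \<Omega> \<Gamma> \<Longrightarrow> q \<in> Q_space \<Omega> \<Longrightarrow> \<alpha> * (VQ_norm \<Omega> v q)\<^sup>2 \<le> a_form \<Omega> C H v q v q"
    and mixed: "mixed_solution \<Omega> \<Gamma> C H \<sigma> f g u p l"
    and aux: "auxiliary_solution \<Omega> \<Gamma> C H f g l' u' p'" and l': "l' \<in> Q_space \<Omega>"
  shows "(VQ_norm \<Omega> (\<lambda>x. u' x - u x) (\<lambda>x. p' x - p x))\<^sup>2
    \<le> (L2_norm (lebesgue_on \<Omega>) (\<lambda>x. l x - l' x))\<^sup>2 / \<alpha>\<^sup>2"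
proof -
  let ?M = "lebesgue_on \<Omega>"
  define N where "N = VQ_norm \<Omega> (\<lambda>x. u' x - u x) (\<lambda>x. p' x - p x)"
  have N: "N \<ge> 0" by (simp add: N_def VQ_norm_nonneg)
  have in_VQ: "u \<in> V_space \<Omega> \<Gamma>" "p \<in> Q_space \<Omega>" "u' \<in> V_space \<Omega> \<Gamma>" "p' \<in> Q_space \<Omega>" and l: "l \<in> Q_space \<Omega>"
    using mixed aux Lambda_setD(1) by (auto simp: mixed_solution_def auxiliary_solution_def)
  have m: "a_form \<Omega> C H u p v q = load \<Omega> f g v - L2_inner ?M l q" if "v \<in> V_space \<Omega> \<Gamma>" "q \<in> Q_space \<Omega>" for v q
    using mixed that by (force simp: mixed_solution_def)
  have a: "a_form \<Omega> C H u' p' v q = load \<Omega> f g v - L2_inner ?M l' q" if "v \<in> V_space \<Omega> \<Gamma>" "q \<in> Q_space \<Omega>" for v q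
    using aux that by (force simp: auxiliary_solution_def)
  have L2: "l \<in> L2_space ?M" "l' \<in> L2_space ?M" "p \<in> L2_space ?M" "p' \<in> L2_space ?M"
    using l l' in_VQ Q_spaceD(1) by auto
  have "\<alpha> * N\<^sup>2 \<le> a_form \<Omega> C H (\<lambda>x. u' x - u x) (\<lambda>x. p' x - p x) (\<lambda>x. u' x - u x) (\<lambda>x. p' x - p x)"
    unfolding N_def using in_VQ by (intro ell V_space_diff Q_space_diff assms)
  also have "\<dots> = a_form \<Omega> C H u' p' u' p' - a_form \<Omega> C H u' p' u p - a_form \<Omega> C H u p u' p' + a_form \<Omega> C H u p u p"
    using in_VQ by (intro a_form_quadratic_diff assms V_space_H1)
  also have "\<dots> = L2_inner ?M (\<lambda>x. l x - l' x) (\<lambda>x. p' x - p x)"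
    using in_VQ L2 by (simp add: m a L2_inner_diff_left L2_inner_diff_right L2_space_diff)
  also have "\<dots> \<le> L2_norm ?M (\<lambda>x. l x - l' x) * L2_norm ?M (\<lambda>x. p' x - p x)"
    using L2_Cauchy_Schwarz[OF L2_space_diff[OF L2(1,2)] L2_space_diff[OF L2(4,3)]] by simp
  also have "\<dots> \<le> L2_norm ?M (\<lambda>x. l x - l' x) * N"
    unfolding N_def by (intro mult_left_mono L2_norm_le_VQ_norm) simp
  finally have "(\<alpha> * N) * N \<le> L2_norm ?M (\<lambda>x. l x - l' x) * N"
    by (simp add: power2_eq_square mult.assoc)
  then have "\<alpha> * N \<le> L2_norm ?M (\<lambda>x. l x - l' x)"
    using N by (cases "N = 0") (auto simp: mult_le_cancel_right)
  then have "(\<alpha> * N)\<^sup>2 \<le> (L2_norm ?M (\<lambda>x. l x - l' x))\<^sup>2"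
    using N assms(6) by (intro power_mono) auto
  then show ?thesis
    using assms(6) by (simp add: N_def power_mult_distrib pos_le_divide_eq mult.commute)
qed

theorem theorem8:
  fixes \<Omega> \<Gamma>\<^sub>D :: "(real^'n::finite) set"
    and \<CC> \<HH> :: "real^'n \<Rightarrow> real^'n^'n \<Rightarrow> real^'n^'n"
    and \<sigma>\<^sub>y :: real
    and f g :: "(real^'n \<Rightarrow> real^'n) \<Rightarrow> real"
  assumes "CARD('n) = 2 \<or> CARD('n) = 3"
    and "polyhedral_lipschitz_domain \<Omega>"
    and "\<Gamma>\<^sub>D \<subseteq> frontier \<Omega>" "closed \<Gamma>\<^sub>D" "emeasure surface_measure \<Gamma>\<^sub>D > 0"
    and "material_tensor \<Omega> \<CC>" "material_tensor \<Omega> \<HH>"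
    and "a_elliptic \<Omega> \<Gamma>\<^sub>D \<CC> \<HH>"
    and "\<sigma>\<^sub>y > 0"
    and "f \<in> dual_space (V_space \<Omega> \<Gamma>\<^sub>D) (norm1 \<Omega>)"
    and "g \<in> dual_space (trace_space \<Omega> \<Gamma>\<^sub>D) (trace_norm \<Omega> \<Gamma>\<^sub>D)"
  shows "\<exists>c>0. \<forall>u p l u\<^sub>N p\<^sub>N l\<^sub>N u' p'.
           mixed_solution \<Omega> \<Gamma>\<^sub>D \<CC> \<HH> \<sigma>\<^sub>y f g u p l \<longrightarrow>
           u\<^sub>N \<in> V_space \<Omega> \<Gamma>\<^sub>D \<longrightarrow> p\<^sub>N \<in> Q_space \<Omega> \<longrightarrow> l\<^sub>N \<in> Q_space \<Omega> \<longrightarrow>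
           auxiliary_solution \<Omega> \<Gamma>\<^sub>D \<CC> \<HH> f g l\<^sub>N u' p' \<longrightarrow>
           mu_star \<sigma>\<^sub>y p\<^sub>N l\<^sub>N \<in> Lambda_set \<Omega> \<sigma>\<^sub>y \<and>
           (VQ_norm \<Omega> (\<lambda>x. u' x - u\<^sub>N x) (\<lambda>x. p' x - p\<^sub>N x))\<^sup>2
             + error_E \<Omega> \<sigma>\<^sub>y p\<^sub>N l\<^sub>N (mu_star \<sigma>\<^sub>y p\<^sub>N l\<^sub>N)
           \<le> c * ((VQ_norm \<Omega> (\<lambda>x. u x - u\<^sub>N x) (\<lambda>x. p x - p\<^sub>N x))\<^sup>2
                  + (L2_norm (lebesgue_on \<Omega>) (\<lambda>x. l x - l\<^sub>N x))\<^sup>2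
                  + L2_norm (lebesgue_on \<Omega>) (\<lambda>x. p x - p\<^sub>N x))"
proof -
  let ?M = "lebesgue_on \<Omega>"
  have \<Omega>: "open \<Omega>" "bounded \<Omega>"
    using assms(2) by (auto simp: polyhedral_lipschitz_domain_def)
  have fin: "finite_measure (surface_measure_on (frontier \<Omega>))"
    using assms(1,2) by (intro surface_measure_frontier_finite) auto
  obtain \<alpha> where \<alpha>: "\<alpha> > 0" and ell: "\<And>v q. v \<in> V_space \<Omega> \<Gamma>\<^sub>D \<Longrightarrow> q \<in> Q_space \<Omega> \<Longrightarrow>
      \<alpha> * (VQ_norm \<Omega> v q)\<^sup>2 \<le> a_form \<Omega> \<CC> \<HH> v q v q"
    using assms(8) by (auto simp: a_elliptic_def)
  define \<kappa> where "\<kappa> = 2 * \<sigma>\<^sub>y * L2_norm ?M (\<lambda>_. 1::real)"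
  have \<kappa>: "\<kappa> \<ge> 0" using assms(9) by (simp add: \<kappa>_def)
  \<comment> \<open>The triangle inequality contributes \<open>2\<close> and \<open>2 / \<alpha>\<^sup>2\<close>, the bound on \<open>E\<close> contributes \<open>1\<close> and \<open>\<kappa>\<close>.\<close>
  define c where "c = 2 + 2 / \<alpha>\<^sup>2 + \<kappa>"
  have "2 / \<alpha>\<^sup>2 \<ge> 0" by simp
  then have c: "c > 0" "2 \<le> c" "2 / \<alpha>\<^sup>2 + 1 \<le> c" "\<kappa> \<le> c"
    using \<kappa> unfolding c_def by linarith+
  show ?thesis
  proof (intro exI[of _ c] conjI allI impI)
    fix u p l u\<^sub>N p\<^sub>N l\<^sub>N u' p'
    assume mixed: "mixed_solution \<Omega> \<Gamma>\<^sub>D \<CC> \<HH> \<sigma>\<^sub>y f g u p l"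
      and N: "u\<^sub>N \<in> V_space \<Omega> \<Gamma>\<^sub>D" "p\<^sub>N \<in> Q_space \<Omega>" "l\<^sub>N \<in> Q_space \<Omega>"
      and aux: "auxiliary_solution \<Omega> \<Gamma>\<^sub>D \<CC> \<HH> f g l\<^sub>N u' p'"
    show "mu_star \<sigma>\<^sub>y p\<^sub>N l\<^sub>N \<in> Lambda_set \<Omega> \<sigma>\<^sub>y"
      using mu_star_in_Lambda[OF \<Omega> assms(9) N(2,3)] .
    have sol: "u \<in> V_space \<Omega> \<Gamma>\<^sub>D" "p \<in> Q_space \<Omega>" "l \<in> Lambda_set \<Omega> \<sigma>\<^sub>y" "u' \<in> V_space \<Omega> \<Gamma>\<^sub>D" "p' \<in> Q_space \<Omega>"
      and var: "\<And>\<mu>. \<mu> \<in> Lambda_set \<Omega> \<sigma>\<^sub>y \<Longrightarrow> L2_inner ?M (\<lambda>x. \<mu> x - l x) p \<le> 0"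
      using mixed aux by (auto simp: mixed_solution_def auxiliary_solution_def)
    define A where "A = (VQ_norm \<Omega> (\<lambda>x. u x - u\<^sub>N x) (\<lambda>x. p x - p\<^sub>N x))\<^sup>2"
    define B where "B = (L2_norm ?M (\<lambda>x. l x - l\<^sub>N x))\<^sup>2"
    define D where "D = L2_norm ?M (\<lambda>x. p x - p\<^sub>N x)"
    have nonneg: "A \<ge> 0" "B \<ge> 0" "D \<ge> 0" by (simp_all add: A_def B_def D_def)
    have "(VQ_norm \<Omega> (\<lambda>x. u' x - u\<^sub>N x) (\<lambda>x. p' x - p\<^sub>N x))\<^sup>2
        \<le> 2 * (VQ_norm \<Omega> (\<lambda>x. u' x - u x) (\<lambda>x. p' x - p x))\<^sup>2 + 2 * A"
      unfolding A_def using sol N by (intro VQ_norm_triangle_squared \<Omega> V_space_H1)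
    also have "\<dots> \<le> 2 / \<alpha>\<^sup>2 * B + 2 * A"
      using auxiliary_error_le[OF \<Omega> fin assms(6,7) \<alpha> ell mixed aux N(3)] by (simp add: B_def)
    finally have 1: "(VQ_norm \<Omega> (\<lambda>x. u' x - u\<^sub>N x) (\<lambda>x. p' x - p\<^sub>N x))\<^sup>2 \<le> 2 / \<alpha>\<^sup>2 * B + 2 * A" .
    have "error_E \<Omega> \<sigma>\<^sub>y p\<^sub>N l\<^sub>N (mu_star \<sigma>\<^sub>y p\<^sub>N l\<^sub>N) \<le> error_E \<Omega> \<sigma>\<^sub>y p\<^sub>N l\<^sub>N l"
      by (rule error_E_mu_star_le[OF \<Omega> assms(9) N(2,3) sol(3)])
    also have "\<dots> \<le> B + \<kappa> * D"
      using dissipation_gap_le[OF \<Omega> assms(9) sol(2) N(2) sol(3) var]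
      by (simp add: error_E_def B_def D_def \<kappa>_def)
    finally have 2: "error_E \<Omega> \<sigma>\<^sub>y p\<^sub>N l\<^sub>N (mu_star \<sigma>\<^sub>y p\<^sub>N l\<^sub>N) \<le> B + \<kappa> * D" .
    have "2 * A \<le> c * A" "(2 / \<alpha>\<^sup>2 + 1) * B \<le> c * B" "\<kappa> * D \<le> c * D"
      using c nonneg by (auto intro!: mult_right_mono)
    then show "(VQ_norm \<Omega> (\<lambda>x. u' x - u\<^sub>N x) (\<lambda>x. p' x - p\<^sub>N x))\<^sup>2
        + error_E \<Omega> \<sigma>\<^sub>y p\<^sub>N l\<^sub>N (mu_star \<sigma>\<^sub>y p\<^sub>N l\<^sub>N)
        \<le> c * ((VQ_norm \<Omega> (\<lambda>x. u x - u\<^sub>N x) (\<lambda>x. p x - p\<^sub>N x))\<^sup>2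
          + (L2_norm ?M (\<lambda>x. l x - l\<^sub>N x))\<^sup>2 + L2_norm ?M (\<lambda>x. p x - p\<^sub>N x))"
      using 1 2 unfolding A_def[symmetric] B_def[symmetric] D_def[symmetric]
      by (simp add: algebra_simps)
  qed (use c in simp)
qed

end
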